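(* Let $U\colon\mathbf{FinSet}/[2]\to\mathbf{FinSet}$ be the forgetful functor from the slice category. There is a monoidal natural transformation $\mathsf{flow}\colon\mathsf{DiffSaddle}\Rightarrow\mathsf{Dynam}\circ U$ whose component at $\tau\colon N\to[2]$, $\mathsf{flow}_\tau\colon\mathsf{DiffSaddle}(\tau)\to\mathsf{Dynam}(N)$, is defined by $$\mathsf{flow}_\tau(f)(x)_i=\begin{cases}-\nabla f(x)_i & \tau(i)=1\\ \nabla f(x)_i & \tau(i)=2\end{cases}$$ for all $x\in\mathbb{R}^N$ and $i\in N$.
   Context: $[2]=\{1,2\}$. $\mathbf{FinSet}/[2]$ is the slice category: objects are functions $\tau\colon N\to[2]$ from finite sets, morphisms $\tau_1\to\tau_2$ are functions $\phi$ between the domains with $\tau_2\circ\phi=\tau_1$; the monoidal product is the coproduct ($N+M$ labelled by the copairing $[\tau_1,\tau_2]$), unit $\emptyset\to[2]$. $U$ sends $\tau\colon N\to[2]$ to $N$ and a morphism to its underlying function. $(\mathbf{FinSet},+)$ has disjoint union and $(\mathbf{Set},\times)$ Cartesian product. For a finite set $N$, $\mathbb{R}^N$ is the vector space of functions $N\to\mathbb{R}$; for $\phi\colon N\to M$, $\phi^*\colon\mathbb{R}^M\to\mathbb{R}^N$ is $\phi^*(y)_i=y_{\phi(i)}$ and $\phi_*\colon\mathbb{R}^N\to\mathbb{R}^M$ is $\phi_*(x)_j=\sum_{i\in\phi^{-1}(j)}x_i$. $\iota_N,\iota_M$ are the inclusions of $N,M$ into $N+M$. $C^1$ denotes once-continuously-differentiable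 functions. $\mathsf{DiffSaddle}\colon(\mathbf{FinSet}/[2],+)\to(\mathbf{Set},\times)$ is the lax symmetric monoidal functor sending $\tau\colon N\to[2]$ to the set of $C^1$ functions $f\colon\mathbb{R}^N\to\mathbb{R}$ that are convex in the coordinates labelled $1$ (for any fixed values of the coordinates labelled $2$) and concave in the coordinates labelled $2$ (for any fixed values of the coordinates labelled $1$); a morphism $\phi$ acts by $f\mapsto f\circ\phi^*$; the product comparison is $(f,g)\mapsto f\circ\iota_N^*+g\circ\iota_M^*$; the unit comparison picks the zero function. $\mathsf{Dynam}\colon(\mathbf{FinSet},+)\to(\mathbf{Set},\times)$ is the lax symmetric monoidal functor with $\mathsf{Dynam}(N)$ the set of smooth maps $\upsilon\colon\mathbb{R}^N\to\mathbb{R}^N$; $\mathsf{Dynam}(\phi)(\upsilon)=\phi_*\circ\upsilon\circ\phi^*$; product comparison $(\upsilon,\rho)\mapsto\iota_{N*}\circ\upsilon\circ\iota_N^*+\iota_{M*}\circ\rho\circ\iota_M^*$; unit comparison the unique map $\{*\}\to\mathsf{Dynam}(\emptyset)$.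
   Formalization: Gradients of C^1 saddle functions need not be smooth (e.g. max(x,0)^2), so the claim is stated for C^(r+1) saddle functions and C^r vector fields, for every r in {0,1,2,...,infinity}; r=0 gives all C^1 saddle functions with continuous fields, r=infinity the smooth case. *)

theory Defs
  imports "HOL-Analysis.Analysis" "HOL-Library.Extended_Nat"
begin

section \<open>Symmetric monoidal categories and set-valued lax symmetric monoidal functors\<close>

text \<open>
  Composition is written in the order of function application: \<open>Comp C g f\<close> is ``\<open>g\<close> after \<open>f\<close>''.
\<close>

record ('o, 'm) smc =
  Obj :: "'o set"
  Hom :: "'o \<Rightarrow> 'o \<Rightarrow> 'm set"
  Ident :: "'o \<Rightarrow> 'm"
  Comp :: "'m \<Rightarrow> 'm \<Rightarrow> 'm"
  TensorObj :: "'o \<Rightarrow> 'o \<Rightarrow> 'o"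
  TensorArr :: "'m \<Rightarrow> 'm \<Rightarrow> 'm"
  UnitObj :: "'o"
  Assoc :: "'o \<Rightarrow> 'o \<Rightarrow> 'o \<Rightarrow> 'm"
  LUnit :: "'o \<Rightarrow> 'm"
  RUnit :: "'o \<Rightarrow> 'm"
  Braid :: "'o \<Rightarrow> 'o \<Rightarrow> 'm"

definition iso_arr :: "('o, 'm) smc \<Rightarrow> 'o \<Rightarrow> 'o \<Rightarrow> 'm \<Rightarrow> bool" where
  "iso_arr C X Y f \<longleftrightarrow> f \<in> Hom C X Y \<and>
     (\<exists>g \<in> Hom C Y X. Comp C g f = Ident C X \<and> Comp C f g = Ident C Y)"

locale category =
  fixes C :: "('o, 'm) smc"
  assumes ident_hom: "X \<in> Obj C \<Longrightarrow> Ident C X \<in> Hom C X X"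
    and comp_hom: "\<lbrakk>X \<in> Obj C; Y \<in> Obj C; Z \<in> Obj C; f \<in> Hom C X Y; g \<in> Hom C Y Z\<rbrakk>
      \<Longrightarrow> Comp C g f \<in> Hom C X Z"
    and comp_ident_right: "\<lbrakk>X \<in> Obj C; Y \<in> Obj C; f \<in> Hom C X Y\<rbrakk> \<Longrightarrow> Comp C f (Ident C X) = f"
    and comp_ident_left: "\<lbrakk>X \<in> Obj C; Y \<in> Obj C; f \<in> Hom C X Y\<rbrakk> \<Longrightarrow> Comp C (Ident C Y) f = f"
    and comp_assoc:
      "\<lbrakk>X \<in> Obj C; Y \<in> Obj C; Z \<in> Obj C; W \<in> Obj C;
        f \<in> Hom C X Y; g \<in> Hom C Y Z; h \<in> Hom C Z W\<rbrakk>
      \<Longrightarrow> Comp C h (Comp C g f) = Comp C (Comp C h g) f"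

locale symmetric_monoidal_category = category C for C :: "('o, 'm) smc" +
  assumes unit_obj: "UnitObj C \<in> Obj C"
    and tensor_obj: "\<lbrakk>X \<in> Obj C; Y \<in> Obj C\<rbrakk> \<Longrightarrow> TensorObj C X Y \<in> Obj C"
    and tensor_hom:
      "\<lbrakk>X \<in> Obj C; Y \<in> Obj C; X' \<in> Obj C; Y' \<in> Obj C; f \<in> Hom C X X'; g \<in> Hom C Y Y'\<rbrakk>
      \<Longrightarrow> TensorArr C f g \<in> Hom C (TensorObj C X Y) (TensorObj C X' Y')"
    and tensor_ident: "\<lbrakk>X \<in> Obj C; Y \<in> Obj C\<rbrakk>
      \<Longrightarrow> TensorArr C (Ident C X) (Ident C Y) = Ident C (TensorObj C X Y)"
    and tensor_comp:
      "\<lbrakk>X \<in> Obj C; Y \<in> Obj C; X' \<in> Obj C; Y' \<in> Obj C; X'' \<in> Obj C; Y'' \<in> Obj C;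
        f \<in> Hom C X X'; f' \<in> Hom C X' X''; g \<in> Hom C Y Y'; g' \<in> Hom C Y' Y''\<rbrakk>
      \<Longrightarrow> TensorArr C (Comp C f' f) (Comp C g' g) = Comp C (TensorArr C f' g') (TensorArr C f g)"
    and assoc_iso: "\<lbrakk>X \<in> Obj C; Y \<in> Obj C; Z \<in> Obj C\<rbrakk>
      \<Longrightarrow> iso_arr C (TensorObj C (TensorObj C X Y) Z) (TensorObj C X (TensorObj C Y Z)) (Assoc C X Y Z)"
    and assoc_natural:
      "\<lbrakk>X \<in> Obj C; Y \<in> Obj C; Z \<in> Obj C; X' \<in> Obj C; Y' \<in> Obj C; Z' \<in> Obj C;
        f \<in> Hom C X X'; g \<in> Hom C Y Y'; h \<in> Hom C Z Z'\<rbrakk>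
      \<Longrightarrow> Comp C (Assoc C X' Y' Z') (TensorArr C (TensorArr C f g) h)
        = Comp C (TensorArr C f (TensorArr C g h)) (Assoc C X Y Z)"
    and lunit_iso: "X \<in> Obj C \<Longrightarrow> iso_arr C (TensorObj C (UnitObj C) X) X (LUnit C X)"
    and lunit_natural: "\<lbrakk>X \<in> Obj C; Y \<in> Obj C; f \<in> Hom C X Y\<rbrakk>
      \<Longrightarrow> Comp C (LUnit C Y) (TensorArr C (Ident C (UnitObj C)) f) = Comp C f (LUnit C X)"
    and runit_iso: "X \<in> Obj C \<Longrightarrow> iso_arr C (TensorObj C X (UnitObj C)) X (RUnit C X)"
    and runit_natural: "\<lbrakk>X \<in> Obj C; Y \<in> Obj C; f \<in> Hom C X Y\<rbrakk>
      \<Longrightarrow> Comp C (RUnit C Y) (TensorArr C f (Ident C (UnitObj C))) = Comp C f (RUnit C X)"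
    and braid_hom: "\<lbrakk>X \<in> Obj C; Y \<in> Obj C\<rbrakk>
      \<Longrightarrow> Braid C X Y \<in> Hom C (TensorObj C X Y) (TensorObj C Y X)"
    and braid_natural:
      "\<lbrakk>X \<in> Obj C; Y \<in> Obj C; X' \<in> Obj C; Y' \<in> Obj C; f \<in> Hom C X X'; g \<in> Hom C Y Y'\<rbrakk>
      \<Longrightarrow> Comp C (Braid C X' Y') (TensorArr C f g) = Comp C (TensorArr C g f) (Braid C X Y)"
    and braid_symmetric: "\<lbrakk>X \<in> Obj C; Y \<in> Obj C\<rbrakk>
      \<Longrightarrow> Comp C (Braid C Y X) (Braid C X Y) = Ident C (TensorObj C X Y)"
    and pentagon: "\<lbrakk>W \<in> Obj C; X \<in> Obj C; Y \<in> Obj C; Z \<in> Obj C\<rbrakk>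
      \<Longrightarrow> Comp C (Assoc C W X (TensorObj C Y Z)) (Assoc C (TensorObj C W X) Y Z)
        = Comp C (TensorArr C (Ident C W) (Assoc C X Y Z))
            (Comp C (Assoc C W (TensorObj C X Y) Z) (TensorArr C (Assoc C W X Y) (Ident C Z)))"
    and triangle: "\<lbrakk>X \<in> Obj C; Y \<in> Obj C\<rbrakk>
      \<Longrightarrow> Comp C (TensorArr C (Ident C X) (LUnit C Y)) (Assoc C X (UnitObj C) Y)
        = TensorArr C (RUnit C X) (Ident C Y)"
    and hexagon: "\<lbrakk>X \<in> Obj C; Y \<in> Obj C; Z \<in> Obj C\<rbrakk>
      \<Longrightarrow> Comp C (Assoc C Y Z X) (Comp C (Braid C X (TensorObj C Y Z)) (Assoc C X Y Z))
        = Comp C (TensorArr C (Ident C Y) (Braid C X Z))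
            (Comp C (Assoc C Y X Z) (TensorArr C (Braid C X Y) (Ident C Z)))"

text \<open>
  The target \<open>(Set, \<times>)\<close> is not represented as a record: a functor into it assigns to each
  object a set of elements of some type and to each arrow a function between these sets, and the
  monoidal product of two sets is the HOL product of sets, with the evident coherence maps.
  The unit comparison, a map from the one-point set, is given by the element that it picks.
\<close>

record ('o, 'm, 'e) set_functor =
  FObj :: "'o \<Rightarrow> 'e set"
  FArr :: "'m \<Rightarrow> 'e \<Rightarrow> 'e"
  FProd :: "'o \<Rightarrow> 'o \<Rightarrow> 'e \<times> 'e \<Rightarrow> 'e"
  FUnit :: "'e"

locale lax_symmetric_monoidal_set_functor = symmetric_monoidal_category C
  for C :: "('o, 'm) smc" +
  fixes F :: "('o, 'm, 'e) set_functor"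
  assumes arr_mem: "\<lbrakk>X \<in> Obj C; Y \<in> Obj C; h \<in> Hom C X Y; a \<in> FObj F X\<rbrakk> \<Longrightarrow> FArr F h a \<in> FObj F Y"
    and arr_ident: "\<lbrakk>X \<in> Obj C; a \<in> FObj F X\<rbrakk> \<Longrightarrow> FArr F (Ident C X) a = a"
    and arr_comp:
      "\<lbrakk>X \<in> Obj C; Y \<in> Obj C; Z \<in> Obj C; h \<in> Hom C X Y; h' \<in> Hom C Y Z; a \<in> FObj F X\<rbrakk>
      \<Longrightarrow> FArr F (Comp C h' h) a = FArr F h' (FArr F h a)"
    and prod_mem: "\<lbrakk>X \<in> Obj C; Y \<in> Obj C; p \<in> FObj F X \<times> FObj F Y\<rbrakk>
      \<Longrightarrow> FProd F X Y p \<in> FObj F (TensorObj C X Y)"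
    and unit_mem: "FUnit F \<in> FObj F (UnitObj C)"
    and prod_natural:
      "\<lbrakk>X \<in> Obj C; Y \<in> Obj C; X' \<in> Obj C; Y' \<in> Obj C; h \<in> Hom C X X'; h' \<in> Hom C Y Y';
        a \<in> FObj F X; b \<in> FObj F Y\<rbrakk>
      \<Longrightarrow> FArr F (TensorArr C h h') (FProd F X Y (a, b)) = FProd F X' Y' (FArr F h a, FArr F h' b)"
    and prod_assoc:
      "\<lbrakk>X \<in> Obj C; Y \<in> Obj C; Z \<in> Obj C; a \<in> FObj F X; b \<in> FObj F Y; c \<in> FObj F Z\<rbrakk>
      \<Longrightarrow> FArr F (Assoc C X Y Z) (FProd F (TensorObj C X Y) Z (FProd F X Y (a, b), c))
        = FProd F X (TensorObj C Y Z) (a, FProd F Y Z (b, c))"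
    and prod_unit_left: "\<lbrakk>X \<in> Obj C; a \<in> FObj F X\<rbrakk>
      \<Longrightarrow> FArr F (LUnit C X) (FProd F (UnitObj C) X (FUnit F, a)) = a"
    and prod_unit_right: "\<lbrakk>X \<in> Obj C; a \<in> FObj F X\<rbrakk>
      \<Longrightarrow> FArr F (RUnit C X) (FProd F X (UnitObj C) (a, FUnit F)) = a"
    and prod_symmetric: "\<lbrakk>X \<in> Obj C; Y \<in> Obj C; a \<in> FObj F X; b \<in> FObj F Y\<rbrakk>
      \<Longrightarrow> FArr F (Braid C X Y) (FProd F X Y (a, b)) = FProd F Y X (b, a)"

locale monoidal_natural_transformation =
  F: lax_symmetric_monoidal_set_functor C F + G: lax_symmetric_monoidal_set_functor C G
  for C :: "('o, 'm) smc" and F :: "('o, 'm, 'e) set_functor" and G :: "('o, 'm, 'd) set_functor" +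
  fixes \<alpha> :: "'o \<Rightarrow> 'e \<Rightarrow> 'd"
  assumes component_mem: "\<lbrakk>X \<in> Obj C; a \<in> FObj F X\<rbrakk> \<Longrightarrow> \<alpha> X a \<in> FObj G X"
    and natural: "\<lbrakk>X \<in> Obj C; Y \<in> Obj C; h \<in> Hom C X Y; a \<in> FObj F X\<rbrakk>
      \<Longrightarrow> \<alpha> Y (FArr F h a) = FArr G h (\<alpha> X a)"
    and monoidal_prod: "\<lbrakk>X \<in> Obj C; Y \<in> Obj C; a \<in> FObj F X; b \<in> FObj F Y\<rbrakk>
      \<Longrightarrow> \<alpha> (TensorObj C X Y) (FProd F X Y (a, b)) = FProd G X Y (\<alpha> X a, \<alpha> Y b)"
    and monoidal_unit: "\<alpha> (UnitObj C) (FUnit F) = FUnit G"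

text \<open>
  Data of a monoidal functor between symmetric monoidal categories: \<open>MProd K X Y\<close> is the
  comparison arrow from \<open>K X \<otimes> K Y\<close> to \<open>K (X \<otimes> Y)\<close>, and \<open>MUnit K\<close> the one from the unit
  object to \<open>K\<close> of the unit object.
\<close>

record ('o, 'm, 'p, 'n) mon_functor =
  MObj :: "'o \<Rightarrow> 'p"
  MArr :: "'m \<Rightarrow> 'n"
  MProd :: "'o \<Rightarrow> 'o \<Rightarrow> 'n"
  MUnit :: "'n"

definition comp_functor ::
  "('p, 'n, 'e) set_functor \<Rightarrow> ('o, 'm, 'p, 'n) mon_functor \<Rightarrow> ('o, 'm, 'e) set_functor"
  (infixr "\<circ>\<^sub>F" 55) where
  "F \<circ>\<^sub>F K = \<lparr>
     FObj = (\<lambda>X. FObj F (MObj K X)),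
     FArr = (\<lambda>h. FArr F (MArr K h)),
     FProd = (\<lambda>X Y p. FArr F (MProd K X Y) (FProd F (MObj K X) (MObj K Y) p)),
     FUnit = FArr F (MUnit K) (FUnit F)\<rparr>"


section \<open>Finite sets and finite sets over $[2]$\<close>

text \<open>
  The elements of the finite sets are drawn from a universe that contains an arbitrary type of
  atoms and is closed under binary disjoint unions, so that the coproduct is an operation on the
  finite sets over one and the same type. Every finite set over every HOL type occurs, up to
  renaming along \<open>Atom\<close>, as an object.
\<close>

datatype 'a elt = Atom 'a | InL "'a elt" | InR "'a elt"

definition dsum :: "'a elt set \<Rightarrow> 'a elt set \<Rightarrow> 'a elt set" (infixr "\<oplus>" 65) where
  "N \<oplus> M = InL ` N \<union> InR ` M"

definition copair ::
  "'a elt set \<Rightarrow> 'a elt set \<Rightarrow> ('a elt \<Rightarrow> 'b) \<Rightarrow> ('a elt \<Rightarrow> 'b) \<Rightarrow> 'a elt \<Rightarrow> 'b" where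
  "copair N M f g = restrict (\<lambda>u. case u of Atom _ \<Rightarrow> undefined | InL i \<Rightarrow> f i | InR j \<Rightarrow> g j) (N \<oplus> M)"

text \<open>The underlying functions of the coherence maps of the coproduct.\<close>

definition sum_map where
  "sum_map N M \<phi> \<psi> = copair N M (InL \<circ> \<phi>) (InR \<circ> \<psi>)"

definition sum_assoc where
  "sum_assoc N M L = copair (N \<oplus> M) L (copair N M InL (InR \<circ> InL)) (InR \<circ> InR)"

definition sum_lunit :: "'a elt set \<Rightarrow> 'a elt \<Rightarrow> 'a elt" where
  "sum_lunit N = copair {} N id id"

definition sum_runit :: "'a elt set \<Rightarrow> 'a elt \<Rightarrow> 'a elt" where
  "sum_runit N = copair N {} id id"

definition sum_braid where
  "sum_braid N M = copair N M InR InL"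

text \<open>
  Arrows are triples of domain, underlying function and codomain. Functions between sets are
  extensional (\<open>undefined\<close> outside of the domain), so that equality of functions between sets is
  HOL equality.
\<close>

type_synonym 'a fin_arr = "'a elt set \<times> ('a elt \<Rightarrow> 'a elt) \<times> 'a elt set"

definition FinSet :: "('a elt set, 'a fin_arr) smc" where
  "FinSet = \<lparr>
     Obj = {N. finite N},
     Hom = (\<lambda>N M. {(N, \<phi>, M) | \<phi>. \<phi> \<in> N \<rightarrow>\<^sub>E M}),
     Ident = (\<lambda>N. (N, \<lambda>i\<in>N. i, N)),
     Comp = (\<lambda>(M', \<psi>, L) (N, \<phi>, M). (N, compose N \<psi> \<phi>, L)),
     TensorObj = (\<oplus>),
     TensorArr = (\<lambda>(N, \<phi>, N') (M, \<psi>, M'). (N \<oplus> M, sum_map N M \<phi> \<psi>, N' \<oplus> M')),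
     UnitObj = {},
     Assoc = (\<lambda>N M L. ((N \<oplus> M) \<oplus> L, sum_assoc N M L, N \<oplus> (M \<oplus> L))),
     LUnit = (\<lambda>N. ({} \<oplus> N, sum_lunit N, N)),
     RUnit = (\<lambda>N. (N \<oplus> {}, sum_runit N, N)),
     Braid = (\<lambda>N M. (N \<oplus> M, sum_braid N M, M \<oplus> N))\<rparr>"

text \<open>An object \<open>\<tau> : N \<rightarrow> [2]\<close> of the slice category is the pair \<open>(N, \<tau>)\<close>.\<close>

type_synonym 'a slice_obj = "'a elt set \<times> ('a elt \<Rightarrow> nat)"
type_synonym 'a slice_arr = "'a slice_obj \<times> ('a elt \<Rightarrow> 'a elt) \<times> 'a slice_obj"

definition slice_sum :: "'a slice_obj \<Rightarrow> 'a slice_obj \<Rightarrow> 'a slice_obj" (infixr "\<oplus>\<^sub>2" 65) where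
  "X \<oplus>\<^sub>2 Y = (fst X \<oplus> fst Y, copair (fst X) (fst Y) (snd X) (snd Y))"

definition slice_empty :: "'a slice_obj" where
  "slice_empty = ({}, \<lambda>_. undefined)"

definition FinSet2 :: "('a slice_obj, 'a slice_arr) smc" where
  "FinSet2 = \<lparr>
     Obj = {(N, \<tau>). finite N \<and> \<tau> \<in> N \<rightarrow>\<^sub>E {1, 2}},
     Hom = (\<lambda>X Y. {(X, \<phi>, Y) | \<phi>. \<phi> \<in> fst X \<rightarrow>\<^sub>E fst Y \<and> (\<forall>i\<in>fst X. snd Y (\<phi> i) = snd X i)}),
     Ident = (\<lambda>X. (X, \<lambda>i\<in>fst X. i, X)),
     Comp = (\<lambda>(Y', \<psi>, Z) (X, \<phi>, Y). (X, compose (fst X) \<psi> \<phi>, Z)),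
     TensorObj = (\<oplus>\<^sub>2),
     TensorArr = (\<lambda>(X, \<phi>, X') (Y, \<psi>, Y'). (X \<oplus>\<^sub>2 Y, sum_map (fst X) (fst Y) \<phi> \<psi>, X' \<oplus>\<^sub>2 Y')),
     UnitObj = slice_empty,
     Assoc = (\<lambda>X Y Z. ((X \<oplus>\<^sub>2 Y) \<oplus>\<^sub>2 Z, sum_assoc (fst X) (fst Y) (fst Z), X \<oplus>\<^sub>2 (Y \<oplus>\<^sub>2 Z))),
     LUnit = (\<lambda>X. (slice_empty \<oplus>\<^sub>2 X, sum_lunit (fst X), X)),
     RUnit = (\<lambda>X. (X \<oplus>\<^sub>2 slice_empty, sum_runit (fst X), X)),
     Braid = (\<lambda>X Y. (X \<oplus>\<^sub>2 Y, sum_braid (fst X) (fst Y), Y \<oplus>\<^sub>2 X))\<rparr>"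

definition U :: "('a slice_obj, 'a slice_arr, 'a elt set, 'a fin_arr) mon_functor" where
  "U = \<lparr>
     MObj = fst,
     MArr = (\<lambda>(X, \<phi>, Y). (fst X, \<phi>, fst Y)),
     MProd = (\<lambda>X Y. Ident FinSet (fst X \<oplus> fst Y)),
     MUnit = Ident FinSet {}\<rparr>"


section \<open>Coordinate spaces and differentiability\<close>

text \<open>
  \<open>\<real>\<^sup>N\<close> is the set of extensional functions from \<open>N\<close> to the reals, the carrier of
  \<^term>\<open>powertop_real N\<close>, which for finite \<open>N\<close> is the usual topology.
\<close>

definition coord_space :: "'i set \<Rightarrow> ('i \<Rightarrow> real) set" where
  "coord_space N = N \<rightarrow>\<^sub>E UNIV"

definition pullback :: "'i set \<Rightarrow> ('i \<Rightarrow> 'j) \<Rightarrow> ('j \<Rightarrow> real) \<Rightarrow> 'i \<Rightarrow> real" where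
  "pullback N \<phi> y = (\<lambda>i\<in>N. y (\<phi> i))"

definition pushforward :: "'i set \<Rightarrow> ('i \<Rightarrow> 'j) \<Rightarrow> 'j set \<Rightarrow> ('i \<Rightarrow> real) \<Rightarrow> 'j \<Rightarrow> real" where
  "pushforward N \<phi> M x = (\<lambda>j\<in>M. \<Sum>i\<in>{i\<in>N. \<phi> i = j}. x i)"

definition partial_deriv :: "'i \<Rightarrow> (('i \<Rightarrow> real) \<Rightarrow> real) \<Rightarrow> ('i \<Rightarrow> real) \<Rightarrow> real" where
  "partial_deriv i f x = deriv (\<lambda>t. f (x(i := t))) (x i)"

definition grad :: "'i set \<Rightarrow> (('i \<Rightarrow> real) \<Rightarrow> real) \<Rightarrow> ('i \<Rightarrow> real) \<Rightarrow> 'i \<Rightarrow> real" where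
  "grad N f x = (\<lambda>i\<in>N. partial_deriv i f x)"

text \<open>All iterated partial derivatives of order up to \<open>n\<close> exist and are continuous on \<open>\<real>\<^sup>N\<close>.\<close>

fun n_times_cont_diff :: "nat \<Rightarrow> 'i set \<Rightarrow> (('i \<Rightarrow> real) \<Rightarrow> real) \<Rightarrow> bool" where
  "n_times_cont_diff 0 N f \<longleftrightarrow> continuous_map (powertop_real N) euclideanreal f"
| "n_times_cont_diff (Suc n) N f \<longleftrightarrow> continuous_map (powertop_real N) euclideanreal f \<and>
     (\<forall>i\<in>N. (\<forall>x\<in>coord_space N. (\<lambda>t. f (x(i := t))) differentiable (at (x i))) \<and>
        n_times_cont_diff n N (partial_deriv i f))"

text \<open>The class \<open>C\<^sup>r\<close> for \<open>r\<close> a natural number or \<open>\<infinity>\<close>.\<close>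

definition C_class :: "enat \<Rightarrow> 'i set \<Rightarrow> (('i \<Rightarrow> real) \<Rightarrow> real) \<Rightarrow> bool" where
  "C_class r N f \<longleftrightarrow> (\<forall>n. enat n \<le> r \<longrightarrow> n_times_cont_diff n N f)"

definition convex_in_coords :: "'i set \<Rightarrow> 'i set \<Rightarrow> (('i \<Rightarrow> real) \<Rightarrow> real) \<Rightarrow> bool" where
  "convex_in_coords N A f \<longleftrightarrow>
     (\<forall>x\<in>coord_space N. \<forall>y\<in>coord_space N. (\<forall>i\<in>N - A. x i = y i) \<longrightarrow>
       (\<forall>t\<in>{0..1}. f (\<lambda>i\<in>N. (1 - t) * x i + t * y i) \<le> (1 - t) * f x + t * f y))"

definition concave_in_coords :: "'i set \<Rightarrow> 'i set \<Rightarrow> (('i \<Rightarrow> real) \<Rightarrow> real) \<Rightarrow> bool" where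
  "concave_in_coords N A f \<longleftrightarrow> convex_in_coords N A (\<lambda>x. - f x)"


section \<open>Differentiable saddle functions and dynamical systems\<close>

text \<open>
  Both functors carry the differentiability class as a parameter. The gradient of a function of
  class \<open>C\<^sup>1\<close> is in general only continuous, so differentiable saddle functions of class
  \<open>C\<^bsup>r+1\<^esup>\<close> are to be paired with vector fields of class \<open>C\<^sup>r\<close>: the case \<open>r = 0\<close> is that of all
  \<open>C\<^sup>1\<close> saddle functions (and continuous vector fields), the case \<open>r = \<infinity>\<close> that of \<open>C\<^sup>\<infinity>\<close> vector
  fields (and \<open>C\<^sup>\<infinity>\<close> saddle functions).
\<close>

definition DiffSaddle ::
  "enat \<Rightarrow> ('a slice_obj, 'a slice_arr, ('a elt \<Rightarrow> real) \<Rightarrow> real) set_functor" where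
  "DiffSaddle r = \<lparr>
     FObj = (\<lambda>(N, \<tau>). {f \<in> coord_space N \<rightarrow>\<^sub>E UNIV. C_class r N f \<and>
       convex_in_coords N {i\<in>N. \<tau> i = 1} f \<and> concave_in_coords N {i\<in>N. \<tau> i = 2} f}),
     FArr = (\<lambda>(X, \<phi>, Y) f. \<lambda>y\<in>coord_space (fst Y). f (pullback (fst X) \<phi> y)),
     FProd = (\<lambda>X Y (f, g). \<lambda>z\<in>coord_space (fst X \<oplus> fst Y).
       f (pullback (fst X) InL z) + g (pullback (fst Y) InR z)),
     FUnit = (\<lambda>x\<in>coord_space {}. 0)\<rparr>"

text \<open>\<open>\<real>\<^sup>\<emptyset>\<close> has one point, so its identity is the only element of \<open>Dynam(\<emptyset>)\<close>.\<close>

definition Dynam ::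
  "enat \<Rightarrow> ('a elt set, 'a fin_arr, ('a elt \<Rightarrow> real) \<Rightarrow> 'a elt \<Rightarrow> real) set_functor" where
  "Dynam r = \<lparr>
     FObj = (\<lambda>N. {\<upsilon> \<in> coord_space N \<rightarrow>\<^sub>E coord_space N. \<forall>i\<in>N. C_class r N (\<lambda>x. \<upsilon> x i)}),
     FArr = (\<lambda>(N, \<phi>, M) \<upsilon>. \<lambda>y\<in>coord_space M. pushforward N \<phi> M (\<upsilon> (pullback N \<phi> y))),
     FProd = (\<lambda>N M (\<upsilon>, \<rho>). \<lambda>z\<in>coord_space (N \<oplus> M). \<lambda>j\<in>N \<oplus> M.
       pushforward N InL (N \<oplus> M) (\<upsilon> (pullback N InL z)) j +
       pushforward M InR (N \<oplus> M) (\<rho> (pullback M InR z)) j),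
     FUnit = (\<lambda>x\<in>coord_space {}. x)\<rparr>"

end

theory Submission
  imports Defs
begin

text \<open>
  Both functors take values in commutative monoids: saddle functions and vector fields can be added
  pointwise, the maps \<open>f \<mapsto> f \<circ> \<phi>\<^sup>*\<close> and \<open>\<upsilon> \<mapsto> \<phi>\<^sub>* \<circ> \<upsilon> \<circ> \<phi>\<^sup>*\<close> are additive, and both product comparisons have
  the same form, \<open>(a, b) \<mapsto> (\<iota>\<^sub>N)\<^sub>\<sharp> a + (\<iota>\<^sub>M)\<^sub>\<sharp> b\<close>, where \<open>h\<^sub>\<sharp>\<close> is the action of an arrow and \<open>\<iota>\<^sub>N\<close>, \<open>\<iota>\<^sub>M\<close> are the
  injections into the coproduct. Any functor into commutative monoids on a category whose tensor
  product is a coproduct becomes lax symmetric monoidal in this way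
  (\<open>additive_set_functor.lax_symmetric_monoidal\<close>), and a natural transformation between two such
  functors that is additive is automatically monoidal (\<open>additive_natural_transformation_monoidal\<close>).

  This leaves the mathematics of the flow itself. It is additive because differentiation is. It is
  natural because of the chain rule \<open>\<nabla>(f \<circ> \<phi>\<^sup>*) = \<phi>\<^sub>* \<circ> \<nabla>f \<circ> \<phi>\<^sup>*\<close> and because the signs depend only on
  the labels, which the arrows of the slice category preserve (\<open>saddle_flow_natural\<close>). As the classes
  of differentiability are given by continuity of iterated partial derivatives, the chain rule
  needs the theorem that continuous partial derivatives make a function differentiable along a
  direction that moves several coordinates at once (\<open>has_derivative_on_block\<close>). The same formula
  shows by induction that pullbacks preserve these classes (\<open>n_times_cont_diff_pullback\<close>).
\<close>

section \<open>Functors into commutative monoids on a cocartesian category\<close>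

text \<open>
  The monoidal product of a coproduct comes with injections, and each coherence map is determined
  by its composites with them. The equations for these composites say how a coherence map transports
  a sum of elements pushed forward along the injections.
\<close>

locale cocartesian_monoidal_category = symmetric_monoidal_category C for C :: "('o, 'm) smc" +
  fixes inl inr :: "'o \<Rightarrow> 'o \<Rightarrow> 'm"
  assumes inl_hom: "\<lbrakk>X \<in> Obj C; Y \<in> Obj C\<rbrakk> \<Longrightarrow> inl X Y \<in> Hom C X (TensorObj C X Y)"
    and inr_hom: "\<lbrakk>X \<in> Obj C; Y \<in> Obj C\<rbrakk> \<Longrightarrow> inr X Y \<in> Hom C Y (TensorObj C X Y)"
    and tensor_inl: "\<lbrakk>X \<in> Obj C; Y \<in> Obj C; X' \<in> Obj C; Y' \<in> Obj C; f \<in> Hom C X X'; g \<in> Hom C Y Y'\<rbrakk>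
      \<Longrightarrow> Comp C (TensorArr C f g) (inl X Y) = Comp C (inl X' Y') f"
    and tensor_inr: "\<lbrakk>X \<in> Obj C; Y \<in> Obj C; X' \<in> Obj C; Y' \<in> Obj C; f \<in> Hom C X X'; g \<in> Hom C Y Y'\<rbrakk>
      \<Longrightarrow> Comp C (TensorArr C f g) (inr X Y) = Comp C (inr X' Y') g"
    and assoc_inl_inl: "\<lbrakk>X \<in> Obj C; Y \<in> Obj C; Z \<in> Obj C\<rbrakk>
      \<Longrightarrow> Comp C (Assoc C X Y Z) (Comp C (inl (TensorObj C X Y) Z) (inl X Y))
        = inl X (TensorObj C Y Z)"
    and assoc_inl_inr: "\<lbrakk>X \<in> Obj C; Y \<in> Obj C; Z \<in> Obj C\<rbrakk>
      \<Longrightarrow> Comp C (Assoc C X Y Z) (Comp C (inl (TensorObj C X Y) Z) (inr X Y))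
        = Comp C (inr X (TensorObj C Y Z)) (inl Y Z)"
    and assoc_inr: "\<lbrakk>X \<in> Obj C; Y \<in> Obj C; Z \<in> Obj C\<rbrakk>
      \<Longrightarrow> Comp C (Assoc C X Y Z) (inr (TensorObj C X Y) Z)
        = Comp C (inr X (TensorObj C Y Z)) (inr Y Z)"
    and lunit_inr: "X \<in> Obj C \<Longrightarrow> Comp C (LUnit C X) (inr (UnitObj C) X) = Ident C X"
    and runit_inl: "X \<in> Obj C \<Longrightarrow> Comp C (RUnit C X) (inl X (UnitObj C)) = Ident C X"
    and braid_inl: "\<lbrakk>X \<in> Obj C; Y \<in> Obj C\<rbrakk> \<Longrightarrow> Comp C (Braid C X Y) (inl X Y) = inr Y X"
    and braid_inr: "\<lbrakk>X \<in> Obj C; Y \<in> Obj C\<rbrakk> \<Longrightarrow> Comp C (Braid C X Y) (inr X Y) = inl Y X"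
begin

lemma assoc_hom: "\<lbrakk>X \<in> Obj C; Y \<in> Obj C; Z \<in> Obj C\<rbrakk>
  \<Longrightarrow> Assoc C X Y Z \<in> Hom C (TensorObj C (TensorObj C X Y) Z) (TensorObj C X (TensorObj C Y Z))"
  using assoc_iso unfolding iso_arr_def by blast

lemma lunit_hom: "X \<in> Obj C \<Longrightarrow> LUnit C X \<in> Hom C (TensorObj C (UnitObj C) X) X"
  using lunit_iso unfolding iso_arr_def by blast

lemma runit_hom: "X \<in> Obj C \<Longrightarrow> RUnit C X \<in> Hom C (TensorObj C X (UnitObj C)) X"
  using runit_iso unfolding iso_arr_def by blast

end

text \<open>
  A functor into commutative monoids, presented by its underlying sets with the monoid structures
  kept apart. Its product comparison is not further data but the sum of the images of the two
  arguments under the injections, and its unit comparison is the zero at the unit object.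
\<close>

locale additive_set_functor = cocartesian_monoidal_category C inl inr
  for C :: "('o, 'm) smc" and inl inr +
  fixes F :: "('o, 'm, 'e) set_functor"
    and add :: "'o \<Rightarrow> 'e \<Rightarrow> 'e \<Rightarrow> 'e" and zero :: "'o \<Rightarrow> 'e"
  assumes map_mem: "\<lbrakk>X \<in> Obj C; Y \<in> Obj C; h \<in> Hom C X Y; a \<in> FObj F X\<rbrakk> \<Longrightarrow> FArr F h a \<in> FObj F Y"
    and map_ident: "\<lbrakk>X \<in> Obj C; a \<in> FObj F X\<rbrakk> \<Longrightarrow> FArr F (Ident C X) a = a"
    and map_comp:
      "\<lbrakk>X \<in> Obj C; Y \<in> Obj C; Z \<in> Obj C; h \<in> Hom C X Y; h' \<in> Hom C Y Z; a \<in> FObj F X\<rbrakk>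
      \<Longrightarrow> FArr F (Comp C h' h) a = FArr F h' (FArr F h a)"
    and add_mem: "\<lbrakk>X \<in> Obj C; a \<in> FObj F X; b \<in> FObj F X\<rbrakk> \<Longrightarrow> add X a b \<in> FObj F X"
    and zero_mem: "X \<in> Obj C \<Longrightarrow> zero X \<in> FObj F X"
    and add_assoc: "\<lbrakk>X \<in> Obj C; a \<in> FObj F X; b \<in> FObj F X; c \<in> FObj F X\<rbrakk>
      \<Longrightarrow> add X (add X a b) c = add X a (add X b c)"
    and add_commute: "\<lbrakk>X \<in> Obj C; a \<in> FObj F X; b \<in> FObj F X\<rbrakk> \<Longrightarrow> add X a b = add X b a"
    and add_zero: "\<lbrakk>X \<in> Obj C; a \<in> FObj F X\<rbrakk> \<Longrightarrow> add X (zero X) a = a"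
    and map_add: "\<lbrakk>X \<in> Obj C; Y \<in> Obj C; h \<in> Hom C X Y; a \<in> FObj F X; b \<in> FObj F X\<rbrakk>
      \<Longrightarrow> FArr F h (add X a b) = add Y (FArr F h a) (FArr F h b)"
    and map_zero: "\<lbrakk>X \<in> Obj C; Y \<in> Obj C; h \<in> Hom C X Y\<rbrakk> \<Longrightarrow> FArr F h (zero X) = zero Y"
    and prod_eq: "\<lbrakk>X \<in> Obj C; Y \<in> Obj C; a \<in> FObj F X; b \<in> FObj F Y\<rbrakk>
      \<Longrightarrow> FProd F X Y (a, b) = add (TensorObj C X Y) (FArr F (inl X Y) a) (FArr F (inr X Y) b)"
    and unit_eq: "FUnit F = zero (UnitObj C)"
begin

text \<open>
  An arrow out of a product acts on a product of elements through its two restrictions. Each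
  coherence law is thereby an identity between composites with the injections.
\<close>

lemma map_prod:
  assumes "X \<in> Obj C" "Y \<in> Obj C" "Z \<in> Obj C" "h \<in> Hom C (TensorObj C X Y) Z"
    and "a \<in> FObj F X" "b \<in> FObj F Y"
  shows "FArr F h (FProd F X Y (a, b))
    = add Z (FArr F (Comp C h (inl X Y)) a) (FArr F (Comp C h (inr X Y)) b)"
  using assms
  by (simp add: prod_eq map_add[of "TensorObj C X Y" Z]
      map_comp[of X "TensorObj C X Y" Z] map_comp[of Y "TensorObj C X Y" Z] 
      tensor_obj inl_hom inr_hom map_mem[of X "TensorObj C X Y"] map_mem[of Y "TensorObj C X Y"])

lemma prod_closed:
  assumes "X \<in> Obj C" "Y \<in> Obj C" "a \<in> FObj F X" "b \<in> FObj F Y"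
  shows "FProd F X Y (a, b) \<in> FObj F (TensorObj C X Y)"
  using assms
  by (simp add: prod_eq add_mem tensor_obj inl_hom inr_hom map_mem[of X "TensorObj C X Y"]
      map_mem[of Y "TensorObj C X Y"])

text \<open>
  Associativity, unit and symmetry of the comparison reduce to the corresponding laws of the
  commutative monoid \<open>F Z\<close> at the codomain \<open>Z\<close> of the coherence map.
\<close>

lemma lax_symmetric_monoidal: "lax_symmetric_monoidal_set_functor C F"
proof unfold_locales
  fix X Y h a
  assume "X \<in> Obj C" "Y \<in> Obj C" "h \<in> Hom C X Y" "a \<in> FObj F X"
  then show "FArr F h a \<in> FObj F Y" by (rule map_mem)
next
  fix X a
  assume "X \<in> Obj C" "a \<in> FObj F X"
  then show "FArr F (Ident C X) a = a" by (rule map_ident)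
next
  fix X Y Z h h' a
  assume "X \<in> Obj C" "Y \<in> Obj C" "Z \<in> Obj C" "h \<in> Hom C X Y" "h' \<in> Hom C Y Z" "a \<in> FObj F X"
  then show "FArr F (Comp C h' h) a = FArr F h' (FArr F h a)" by (rule map_comp)
next
  fix X Y p
  assume "X \<in> Obj C" "Y \<in> Obj C" "p \<in> FObj F X \<times> FObj F Y"
  then show "FProd F X Y p \<in> FObj F (TensorObj C X Y)"
    by (auto intro: prod_closed)
next
  show "FUnit F \<in> FObj F (UnitObj C)"
    by (simp add: unit_eq zero_mem unit_obj)
next
  fix X Y X' Y' h h' a b
  assume obj: "X \<in> Obj C" "Y \<in> Obj C" "X' \<in> Obj C" "Y' \<in> Obj C"
    and hom: "h \<in> Hom C X X'" "h' \<in> Hom C Y Y'" and mem: "a \<in> FObj F X" "b \<in> FObj F Y"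
  have "FArr F (TensorArr C h h') (FProd F X Y (a, b))
      = add (TensorObj C X' Y') (FArr F (Comp C (inl X' Y') h) a) (FArr F (Comp C (inr X' Y') h') b)"
    using obj hom mem
    by (simp add: map_prod[where Z = "TensorObj C X' Y'"] tensor_obj tensor_hom tensor_inl tensor_inr)
  also have "\<dots> = FProd F X' Y' (FArr F h a, FArr F h' b)"
    using obj hom mem
    by (simp add: prod_eq map_mem[of X X'] map_mem[of Y Y'] tensor_obj inl_hom inr_hom
        map_comp[of X X' "TensorObj C X' Y'"] map_comp[of Y Y' "TensorObj C X' Y'"])
  finally show "FArr F (TensorArr C h h') (FProd F X Y (a, b)) = FProd F X' Y' (FArr F h a, FArr F h' b)" .
next
  fix X Y Z a b c
  assume obj: "X \<in> Obj C" "Y \<in> Obj C" "Z \<in> Obj C"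
    and mem: "a \<in> FObj F X" "b \<in> FObj F Y" "c \<in> FObj F Z"
  let ?XY = "TensorObj C X Y" and ?YZ = "TensorObj C Y Z"
  let ?L = "TensorObj C ?XY Z" and ?R = "TensorObj C X ?YZ"
  let ?a = "FArr F (inl X ?YZ) a" and ?b = "FArr F (Comp C (inr X ?YZ) (inl Y Z)) b"
    and ?c = "FArr F (Comp C (inr X ?YZ) (inr Y Z)) c"
  have T: "?XY \<in> Obj C" "?YZ \<in> Obj C" "?L \<in> Obj C" "?R \<in> Obj C"
    using obj by (simp_all add: tensor_obj)
  have A: "Comp C (Assoc C X Y Z) (inl ?XY Z) \<in> Hom C ?XY ?R"
    using obj T by (blast intro: comp_hom assoc_hom inl_hom)
  have assocs: "Comp C (Comp C (Assoc C X Y Z) (inl ?XY Z)) (inl X Y) = inl X ?YZ"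
      "Comp C (Comp C (Assoc C X Y Z) (inl ?XY Z)) (inr X Y) = Comp C (inr X ?YZ) (inl Y Z)"
    using obj T comp_assoc[of X ?XY ?L ?R "inl X Y" "inl ?XY Z" "Assoc C X Y Z"]
      comp_assoc[of Y ?XY ?L ?R "inr X Y" "inl ?XY Z" "Assoc C X Y Z"]
    by (simp_all add: inl_hom inr_hom assoc_hom assoc_inl_inl assoc_inl_inr)
  have homs: "Comp C (inr X ?YZ) (inl Y Z) \<in> Hom C Y ?R" "Comp C (inr X ?YZ) (inr Y Z) \<in> Hom C Z ?R"
    using obj T by (blast intro: comp_hom inl_hom inr_hom)+
  have mems: "?a \<in> FObj F ?R" "?b \<in> FObj F ?R" "?c \<in> FObj F ?R"
    using obj T mem homs
    by (simp_all add: map_mem[of X ?R] map_mem[of Y ?R] map_mem[of Z ?R] inl_hom)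
  have "FArr F (Assoc C X Y Z) (FProd F ?XY Z (FProd F X Y (a, b), c))
      = add ?R (FArr F (Comp C (Assoc C X Y Z) (inl ?XY Z)) (FProd F X Y (a, b))) ?c"
    using obj T mem by (simp add: map_prod[where Z = ?R] assoc_hom prod_closed assoc_inr)
  also have "\<dots> = add ?R (add ?R ?a ?b) ?c"
    using obj T mem A by (simp add: map_prod[where Z = ?R] assocs)
  also have "\<dots> = add ?R ?a (add ?R ?b ?c)"
    using T mems by (simp add: add_assoc)
  also have "\<dots> = FProd F X ?YZ (a, FProd F Y Z (b, c))"
    using obj T mem
    by (simp add: prod_eq[of X ?YZ] prod_closed map_prod[where Z = ?R] inr_hom)
  finally show "FArr F (Assoc C X Y Z) (FProd F ?XY Z (FProd F X Y (a, b), c))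
      = FProd F X ?YZ (a, FProd F Y Z (b, c))" .
next
  fix X a
  assume X: "X \<in> Obj C" and a: "a \<in> FObj F X"
  \<comment> \<open>The first summand is the image of the zero at the unit object, hence itself a zero.\<close>
  have "Comp C (LUnit C X) (inl (UnitObj C) X) \<in> Hom C (UnitObj C) X"
    using X by (blast intro: comp_hom lunit_hom inl_hom unit_obj tensor_obj)
  then show "FArr F (LUnit C X) (FProd F (UnitObj C) X (FUnit F, a)) = a"
    using X a
    by (simp add: map_prod[where Z = X] unit_eq lunit_hom unit_obj zero_mem lunit_inr map_ident
        map_zero[of "UnitObj C" X] add_zero)
next
  fix X a
  assume X: "X \<in> Obj C" and a: "a \<in> FObj F X"
  have "Comp C (RUnit C X) (inr X (UnitObj C)) \<in> Hom C (UnitObj C) X"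
    using X by (blast intro: comp_hom runit_hom inr_hom unit_obj tensor_obj)
  then show "FArr F (RUnit C X) (FProd F X (UnitObj C) (a, FUnit F)) = a"
    using X a
    by (simp add: map_prod[where Z = X] unit_eq runit_hom unit_obj zero_mem runit_inl map_ident
        map_zero[of "UnitObj C" X] add_zero add_commute[of X a])
next
  fix X Y a b
  assume obj: "X \<in> Obj C" "Y \<in> Obj C" and mem: "a \<in> FObj F X" "b \<in> FObj F Y"
  then show "FArr F (Braid C X Y) (FProd F X Y (a, b)) = FProd F Y X (b, a)"
    by (simp add: map_prod[where Z = "TensorObj C Y X"] tensor_obj braid_hom braid_inl braid_inr
        prod_eq[of Y X] add_commute[of "TensorObj C Y X" "FArr F (inr Y X) a"]
        map_mem[of X "TensorObj C Y X"] map_mem[of Y "TensorObj C Y X"] inl_hom inr_hom)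
qed

end

text \<open>
  Compatibility with the products is free: naturality at the injections moves the transformation
  past the two images, and additivity moves it past their sum.
\<close>

lemma additive_natural_transformation_monoidal:
  assumes F: "additive_set_functor C inl inr F addF zeroF"
    and G: "additive_set_functor C inl inr G addG zeroG"
    and mem: "\<And>X a. \<lbrakk>X \<in> Obj C; a \<in> FObj F X\<rbrakk> \<Longrightarrow> \<alpha> X a \<in> FObj G X"
    and natural: "\<And>X Y h a. \<lbrakk>X \<in> Obj C; Y \<in> Obj C; h \<in> Hom C X Y; a \<in> FObj F X\<rbrakk>
      \<Longrightarrow> \<alpha> Y (FArr F h a) = FArr G h (\<alpha> X a)"
    and additive: "\<And>X a b. \<lbrakk>X \<in> Obj C; a \<in> FObj F X; b \<in> FObj F X\<rbrakk>
      \<Longrightarrow> \<alpha> X (addF X a b) = addG X (\<alpha> X a) (\<alpha> X b)"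
    and zero: "\<And>X. X \<in> Obj C \<Longrightarrow> \<alpha> X (zeroF X) = zeroG X"
  shows "monoidal_natural_transformation C F G \<alpha>"
proof -
  interpret F: additive_set_functor C inl inr F addF zeroF by (rule F)
  interpret G: additive_set_functor C inl inr G addG zeroG by (rule G)
  interpret F': lax_symmetric_monoidal_set_functor C F by (rule F.lax_symmetric_monoidal)
  interpret G': lax_symmetric_monoidal_set_functor C G by (rule G.lax_symmetric_monoidal)
  show ?thesis
  proof unfold_locales
    fix X Y a b
    assume obj: "X \<in> Obj C" "Y \<in> Obj C" and ab: "a \<in> FObj F X" "b \<in> FObj F Y"
    let ?XY = "TensorObj C X Y"
    have "?XY \<in> Obj C" "inl X Y \<in> Hom C X ?XY" "inr X Y \<in> Hom C Y ?XY"
      using obj by (simp_all add: F.tensor_obj F.inl_hom F.inr_hom)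
    then show "\<alpha> ?XY (FProd F X Y (a, b)) = FProd G X Y (\<alpha> X a, \<alpha> Y b)"
      using obj ab
      by (simp add: F.prod_eq G.prod_eq mem additive F.map_mem[of X ?XY] F.map_mem[of Y ?XY]
          natural[of X ?XY] natural[of Y ?XY])
  next
    show "\<alpha> (UnitObj C) (FUnit F) = FUnit G"
      by (simp add: F.unit_eq G.unit_eq zero F.unit_obj)
  qed (use mem natural in auto)
qed

section \<open>The category of finite sets over two labels\<close>

lemma InL_mem_dsum [simp]: "InL i \<in> N \<oplus> M \<longleftrightarrow> i \<in> N"
  by (auto simp: dsum_def)

lemma InR_mem_dsum [simp]: "InR j \<in> N \<oplus> M \<longleftrightarrow> j \<in> M"
  by (auto simp: dsum_def)

lemma dsumE [elim!]:
  assumes "u \<in> N \<oplus> M"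
  obtains i where "u = InL i" "i \<in> N" | j where "u = InR j" "j \<in> M"
  using assms by (auto simp: dsum_def)

lemma finite_dsum [simp]: "finite N \<Longrightarrow> finite M \<Longrightarrow> finite (N \<oplus> M)"
  by (auto simp: dsum_def)

lemma copair_InL [simp]: "i \<in> N \<Longrightarrow> copair N M f g (InL i) = f i"
  by (simp add: copair_def)

lemma copair_InR [simp]: "j \<in> M \<Longrightarrow> copair N M f g (InR j) = g j"
  by (simp add: copair_def)

lemma copair_extensional [simp]: "copair N M f g \<in> extensional (N \<oplus> M)"
  by (simp add: copair_def)

lemmas coherence_defs = sum_map_def sum_assoc_def sum_lunit_def sum_runit_def sum_braid_def

lemma Obj_FinSet2: "X \<in> Obj FinSet2 \<longleftrightarrow>
  finite (fst X) \<and> snd X \<in> extensional (fst X) \<and> (\<forall>i\<in>fst X. snd X i \<in> {1, 2})"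
  by (auto simp: FinSet2_def PiE_def)

lemma Hom_FinSet2 [simp]: "(X', \<phi>, Y') \<in> Hom FinSet2 X Y \<longleftrightarrow> X' = X \<and> Y' = Y \<and>
  \<phi> \<in> extensional (fst X) \<and> (\<forall>i\<in>fst X. \<phi> i \<in> fst Y \<and> snd Y (\<phi> i) = snd X i)"
  by (auto simp: FinSet2_def PiE_def)

lemma Hom_FinSet2E:
  assumes "h \<in> Hom FinSet2 X Y"
  obtains \<phi> where "h = (X, \<phi>, Y)" "\<phi> \<in> extensional (fst X)"
    "\<And>i. i \<in> fst X \<Longrightarrow> \<phi> i \<in> fst Y" "\<And>i. i \<in> fst X \<Longrightarrow> snd Y (\<phi> i) = snd X i"
  using assms by (auto simp: FinSet2_def PiE_def)

lemma FinSet2_simps: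
  "Ident FinSet2 X = (X, \<lambda>i\<in>fst X. i, X)"
  "Comp FinSet2 (Y', \<psi>, Z) (X, \<phi>, Y) = (X, compose (fst X) \<psi> \<phi>, Z)"
  "TensorObj FinSet2 = (\<oplus>\<^sub>2)"
  "TensorArr FinSet2 (X, \<phi>, X') (Y, \<psi>, Y') = (X \<oplus>\<^sub>2 Y, sum_map (fst X) (fst Y) \<phi> \<psi>, X' \<oplus>\<^sub>2 Y')"
  "UnitObj FinSet2 = slice_empty"
  "Assoc FinSet2 X Y Z = ((X \<oplus>\<^sub>2 Y) \<oplus>\<^sub>2 Z, sum_assoc (fst X) (fst Y) (fst Z), X \<oplus>\<^sub>2 (Y \<oplus>\<^sub>2 Z))"
  "LUnit FinSet2 X = (slice_empty \<oplus>\<^sub>2 X, sum_lunit (fst X), X)"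
  "RUnit FinSet2 X = (X \<oplus>\<^sub>2 slice_empty, sum_runit (fst X), X)"
  "Braid FinSet2 X Y = (X \<oplus>\<^sub>2 Y, sum_braid (fst X) (fst Y), Y \<oplus>\<^sub>2 X)"
  by (simp_all add: FinSet2_def)

lemma slice_sum_simps [simp]:
  "fst (X \<oplus>\<^sub>2 Y) = fst X \<oplus> fst Y"
  "snd (X \<oplus>\<^sub>2 Y) = copair (fst X) (fst Y) (snd X) (snd Y)"
  "fst slice_empty = {}"
  "snd slice_empty = (\<lambda>_. undefined)"
  by (simp_all add: slice_sum_def slice_empty_def)

definition slice_inl :: "'a slice_obj \<Rightarrow> 'a slice_obj \<Rightarrow> 'a slice_arr" where
  "slice_inl X Y = (X, \<lambda>i\<in>fst X. InL i, X \<oplus>\<^sub>2 Y)"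

definition slice_inr :: "'a slice_obj \<Rightarrow> 'a slice_obj \<Rightarrow> 'a slice_arr" where
  "slice_inr X Y = (Y, \<lambda>j\<in>fst Y. InR j, X \<oplus>\<^sub>2 Y)"

lemma compose_extensional [simp]: "compose S g f \<in> extensional S"
  by (simp add: compose_def)

lemma compose_apply [simp]: "i \<in> S \<Longrightarrow> compose S g f i = g (f i)"
  by (simp add: compose_def)

text \<open>
  The inverse of a bijection that preserves labels preserves them as well, so it suffices to invert
  the underlying function.
\<close>

lemma iso_arr_FinSet2I:
  assumes \<phi>: "(X, \<phi>, Y) \<in> Hom FinSet2 X Y"
    and \<psi>: "\<And>j. j \<in> fst Y \<Longrightarrow> \<psi> j \<in> fst X"
    and inv: "\<And>i. i \<in> fst X \<Longrightarrow> \<psi> (\<phi> i) = i" "\<And>j. j \<in> fst Y \<Longrightarrow> \<phi> (\<psi> j) = j"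
  shows "iso_arr FinSet2 X Y (X, \<phi>, Y)"
  unfolding iso_arr_def
proof (intro conjI bexI)
  have "snd X (\<psi> j) = snd Y j" if "j \<in> fst Y" for j
    using that \<phi> \<psi>[OF that] inv(2)[OF that] by (metis Hom_FinSet2)
  then show "(Y, restrict \<psi> (fst Y), X) \<in> Hom FinSet2 Y X"
    using \<psi> by simp
  show "Comp FinSet2 (Y, restrict \<psi> (fst Y), X) (X, \<phi>, Y) = Ident FinSet2 X"
    using \<phi> inv(1) by (auto simp: FinSet2_simps intro!: extensionalityI[where A = "fst X"])
  show "Comp FinSet2 (X, \<phi>, Y) (Y, restrict \<psi> (fst Y), X) = Ident FinSet2 Y"
    using inv(2) by (auto simp: FinSet2_simps intro!: extensionalityI[where A = "fst Y"])
qed (rule \<phi>)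

lemma FinSet2_category: "category FinSet2"
proof (unfold_locales, goal_cases ident_hom comp_hom comp_ident_right comp_ident_left comp_assoc)
  case (ident_hom X)
  then show ?case by (simp add: FinSet2_simps)
next
  case (comp_hom X Y Z f g)
  then show ?case by (auto simp: FinSet2_simps elim!: Hom_FinSet2E)
next
  case (comp_ident_right X Y f)
  then show ?case
    by (auto simp: FinSet2_simps elim!: Hom_FinSet2E intro!: extensionalityI[where A = "fst X"])
next
  case (comp_ident_left X Y f)
  then show ?case
    by (auto simp: FinSet2_simps elim!: Hom_FinSet2E intro!: extensionalityI[where A = "fst X"])
next
  case (comp_assoc X Y Z W f g h)
  then show ?case
    by (auto simp: FinSet2_simps elim!: Hom_FinSet2E intro!: extensionalityI[where A = "fst X"])
qed

text \<open>
  Every law is an equality of extensional functions on a disjoint union, which is checked on each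
  summand.
\<close>

lemma FinSet2_symmetric_monoidal: "symmetric_monoidal_category FinSet2"
proof -
  interpret category FinSet2 by (rule FinSet2_category)
  show ?thesis
  proof (unfold_locales, goal_cases unit_obj tensor_obj tensor_hom tensor_ident tensor_comp
      assoc_iso assoc_natural lunit_iso lunit_natural runit_iso runit_natural
      braid_hom braid_natural braid_symmetric pentagon triangle hexagon)
    case unit_obj
    then show ?case by (simp add: FinSet2_simps Obj_FinSet2 extensional_def)
  next
    case tensor_obj
    then show ?case by (auto simp: FinSet2_simps Obj_FinSet2)
  next
    case tensor_hom
    then show ?case by (auto simp: FinSet2_simps coherence_defs elim!: Hom_FinSet2E)
  next
    case (tensor_ident X Y)
    then show ?case
      by (auto simp: FinSet2_simps coherence_defs
          intro!: extensionalityI[where A = "fst X \<oplus> fst Y"])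
  next
    case (tensor_comp X Y)
    then show ?case
      by (auto simp: FinSet2_simps coherence_defs elim!: Hom_FinSet2E 
          intro!: extensionalityI[where A = "fst X \<oplus> fst Y"])
  next
    case (assoc_iso X Y Z)
    show ?case
      unfolding FinSet2_simps
      by (rule iso_arr_FinSet2I[where \<psi> = "copair (fst X) (fst Y \<oplus> fst Z) (InL \<circ> InL)
          (copair (fst Y) (fst Z) (InL \<circ> InR) InR)"])
        (auto simp: coherence_defs)
  next
    case (assoc_natural X Y Z)
    then show ?case
      by (auto simp: FinSet2_simps coherence_defs elim!: Hom_FinSet2E 
          intro!: extensionalityI[where A = "(fst X \<oplus> fst Y) \<oplus> fst Z"])
  next
    case (lunit_iso X)
    show ?case
      unfolding FinSet2_simps
      by (rule iso_arr_FinSet2I[where \<psi> = InR]) (auto simp: coherence_defs)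
  next
    case (lunit_natural X)
    then show ?case
      by (auto simp: FinSet2_simps coherence_defs elim!: Hom_FinSet2E 
          intro!: extensionalityI[where A = "{} \<oplus> fst X"])
  next
    case (runit_iso X)
    show ?case
      unfolding FinSet2_simps
      by (rule iso_arr_FinSet2I[where \<psi> = InL]) (auto simp: coherence_defs)
  next
    case (runit_natural X)
    then show ?case
      by (auto simp: FinSet2_simps coherence_defs elim!: Hom_FinSet2E 
          intro!: extensionalityI[where A = "fst X \<oplus> {}"])
  next
    case braid_hom
    then show ?case by (auto simp: FinSet2_simps coherence_defs)
  next
    case (braid_natural X Y)
    then show ?case
      by (auto simp: FinSet2_simps coherence_defs elim!: Hom_FinSet2E 
          intro!: extensionalityI[where A = "fst X \<oplus> fst Y"])
  next
    case (braid_symmetric X Y)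
    then show ?case
      by (auto simp: FinSet2_simps coherence_defs
          intro!: extensionalityI[where A = "fst X \<oplus> fst Y"])
  next
    case (pentagon W X Y Z)
    then show ?case
      by (auto simp: FinSet2_simps coherence_defs
          intro!: extensionalityI[where A = "((fst W \<oplus> fst X) \<oplus> fst Y) \<oplus> fst Z"])
  next
    case (triangle X Y)
    then show ?case
      by (auto simp: FinSet2_simps coherence_defs
          intro!: extensionalityI[where A = "(fst X \<oplus> {}) \<oplus> fst Y"])
  next
    case (hexagon X Y Z)
    then show ?case
      by (auto simp: FinSet2_simps coherence_defs
          intro!: extensionalityI[where A = "(fst X \<oplus> fst Y) \<oplus> fst Z"])
  qed
qed

lemma FinSet2_cocartesian: "cocartesian_monoidal_category FinSet2 slice_inl slice_inr"
proof -
  interpret symmetric_monoidal_category FinSet2 by (rule FinSet2_symmetric_monoidal)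
  show ?thesis
  proof (unfold_locales, goal_cases inl_hom inr_hom tensor_inl tensor_inr assoc_inl_inl assoc_inl_inr
      assoc_inr lunit_inr runit_inl braid_inl braid_inr)
    case inl_hom
    then show ?case
      by (auto simp: FinSet2_simps slice_inl_def slice_inr_def coherence_defs)
  next
    case inr_hom
    then show ?case
      by (auto simp: FinSet2_simps slice_inl_def slice_inr_def coherence_defs)
  next
    case (tensor_inl X Y)
    then show ?case
      by (auto simp: FinSet2_simps slice_inl_def slice_inr_def coherence_defs elim!: Hom_FinSet2E
          intro!: extensionalityI[where A = "fst X"])
  next
    case (tensor_inr X Y)
    then show ?case
      by (auto simp: FinSet2_simps slice_inl_def slice_inr_def coherence_defs elim!: Hom_FinSet2E
          intro!: extensionalityI[where A = "fst Y"])
  next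
    case (assoc_inl_inl X Y Z)
    then show ?case
      by (auto simp: FinSet2_simps slice_inl_def slice_inr_def coherence_defs
          intro!: extensionalityI[where A = "fst X"])
  next
    case (assoc_inl_inr X Y Z)
    then show ?case
      by (auto simp: FinSet2_simps slice_inl_def slice_inr_def coherence_defs
          intro!: extensionalityI[where A = "fst Y"])
  next
    case (assoc_inr X Y Z)
    then show ?case
      by (auto simp: FinSet2_simps slice_inl_def slice_inr_def coherence_defs
          intro!: extensionalityI[where A = "fst Z"])
  next
    case (lunit_inr X)
    then show ?case
      by (auto simp: FinSet2_simps slice_inl_def slice_inr_def coherence_defs
          intro!: extensionalityI[where A = "fst X"])
  next
    case (runit_inl X)
    then show ?case
      by (auto simp: FinSet2_simps slice_inl_def slice_inr_def coherence_defs
          intro!: extensionalityI[where A = "fst X"])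
  next
    case (braid_inl X Y)
    then show ?case
      by (auto simp: FinSet2_simps slice_inl_def slice_inr_def coherence_defs
          intro!: extensionalityI[where A = "fst X"])
  next
    case (braid_inr X Y)
    then show ?case
      by (auto simp: FinSet2_simps slice_inl_def slice_inr_def coherence_defs
          intro!: extensionalityI[where A = "fst Y"])
  qed
qed

section \<open>Pullback, pushforward and iterated partial derivatives\<close>

lemma coord_space_upd: "x \<in> coord_space N \<Longrightarrow> i \<in> N \<Longrightarrow> x(i := t) \<in> coord_space N"
  by (auto simp: coord_space_def PiE_def extensional_def)

lemma restrict_coord_space [simp]: "restrict x N \<in> coord_space N"
  by (simp add: coord_space_def)

lemma pullback_coord_space [simp]: "pullback N \<phi> y \<in> coord_space N"
  by (simp add: pullback_def)

lemma pullback_apply [simp]: "i \<in> N \<Longrightarrow> pullback N \<phi> y i = y (\<phi> i)"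
  by (simp add: pullback_def)

lemma pushforward_coord_space [simp]: "pushforward N \<phi> M x \<in> coord_space M"
  by (simp add: pushforward_def)

lemma topspace_powertop_coord_space [simp]: "topspace (powertop_real N) = coord_space N"
  by (simp add: coord_space_def)

lemma continuous_map_pullback:
  assumes "\<phi> \<in> N \<rightarrow> M"
  shows "continuous_map (powertop_real M) (powertop_real N) (pullback N \<phi>)"
proof -
  have "continuous_map (powertop_real M) euclideanreal (\<lambda>y. pullback N \<phi> y i)" if "i \<in> N" for i
    using that assms continuous_map_product_projection[of "\<phi> i" M "\<lambda>_. euclideanreal"]
    by (auto simp: pullback_def)
  then show ?thesis
    by (auto simp: continuous_map_componentwise pullback_def)
qed

lemma n_times_cont_diff_continuous:
  "n_times_cont_diff n N f \<Longrightarrow> continuous_map (powertop_real N) euclideanreal f"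
  by (cases n) auto

text \<open>
  Functions are only meaningful on \<^term>\<open>coord_space N\<close>, while their partial derivatives come out of
  \<^const>\<open>deriv\<close> as total functions. The congruence rules below make it legitimate to compute with
  any expression that gives the right values on the coordinate space.
\<close>

lemma partial_deriv_cong:
  assumes "\<And>x. x \<in> coord_space N \<Longrightarrow> f x = g x" "x \<in> coord_space N" "i \<in> N"
  shows "partial_deriv i f x = partial_deriv i g x"
proof -
  have "(\<lambda>t. f (x(i := t))) = (\<lambda>t. g (x(i := t)))"
    using assms by (auto simp: coord_space_upd)
  then show ?thesis
    by (simp add: partial_deriv_def)
qed

lemma n_times_cont_diff_cong:
  assumes "\<And>x. x \<in> coord_space N \<Longrightarrow> f x = g x" "n_times_cont_diff n N f"
  shows "n_times_cont_diff n N g"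
  using assms
proof (induction n arbitrary: f g)
  case 0
  then show ?case
    by (auto simp: coord_space_def elim!: continuous_map_eq)
next
  case (Suc n)
  have "continuous_map (powertop_real N) euclideanreal g"
    using Suc.prems by (auto simp: coord_space_def elim!: continuous_map_eq)
  moreover have "(\<lambda>t. g (x(i := t))) differentiable (at (x i))" if "i \<in> N" "x \<in> coord_space N" for i x
  proof -
    have "(\<lambda>t. f (x(i := t))) differentiable (at (x i))"
      using Suc.prems(2) that by simp
    also have "(\<lambda>t. f (x(i := t))) = (\<lambda>t. g (x(i := t)))"
      by (rule ext) (rule Suc.prems(1)[OF coord_space_upd[OF that(2,1)]])
    finally show ?thesis .
  qed
  moreover have "n_times_cont_diff n N (partial_deriv i g)" if i: "i \<in> N" for i
  proof (rule Suc.IH)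
    show "partial_deriv i f x = partial_deriv i g x" if "x \<in> coord_space N" for x
      by (rule partial_deriv_cong[OF Suc.prems(1) that i])
    show "n_times_cont_diff n N (partial_deriv i f)"
      using Suc.prems(2) i by simp
  qed
  ultimately show ?case
    using Suc.prems(2) by simp
qed

lemma has_partial_deriv:
  assumes "n_times_cont_diff (Suc n) N f" "i \<in> N" "x \<in> coord_space N"
  shows "((\<lambda>t. f (x(i := t))) has_real_derivative partial_deriv i f (x(i := s))) (at s)"
proof -
  have "\<forall>y\<in>coord_space N. (\<lambda>t. f (y(i := t))) differentiable (at (y i))"
    using assms(1,2) by simp
  from bspec[OF this coord_space_upd[OF assms(3,2)], of s]
  have "(\<lambda>t. f (x(i := t))) differentiable (at s)"
    by simp
  then show ?thesis
    by (simp add: partial_deriv_def DERIV_deriv_iff_real_differentiable)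
qed

lemma has_partial_deriv_add:
  assumes "n_times_cont_diff (Suc n) N f" "n_times_cont_diff (Suc m) N g" "i \<in> N" "x \<in> coord_space N"
  shows "((\<lambda>t. f (x(i := t)) + g (x(i := t))) has_real_derivative
      partial_deriv i f x + partial_deriv i g x) (at (x i))"
  using has_partial_deriv[OF assms(1,3,4), of "x i"] has_partial_deriv[OF assms(2,3,4), of "x i"]
  by (auto intro: derivative_intros)

lemma partial_deriv_add:
  assumes "n_times_cont_diff (Suc n) N f" "n_times_cont_diff (Suc m) N g" "i \<in> N" "x \<in> coord_space N"
  shows "partial_deriv i (\<lambda>x. f x + g x) x = partial_deriv i f x + partial_deriv i g x"
  using has_partial_deriv_add[OF assms] by (simp add: partial_deriv_def[of i "\<lambda>x. f x + g x"] DERIV_imp_deriv)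

lemma n_times_cont_diff_add:
  assumes "n_times_cont_diff n N f" "n_times_cont_diff n N g"
  shows "n_times_cont_diff n N (\<lambda>x. f x + g x)"
  using assms
proof (induction n arbitrary: f g)
  case 0
  then show ?case
    by (simp add: continuous_map_add)
next
  case (Suc n)
  have "n_times_cont_diff n N (partial_deriv i (\<lambda>x. f x + g x))" if i: "i \<in> N" for i
  proof (rule n_times_cont_diff_cong)
    show "n_times_cont_diff n N (\<lambda>x. partial_deriv i f x + partial_deriv i g x)"
      using Suc i by simp
  qed (simp add: partial_deriv_add[OF Suc.prems i])
  moreover have "(\<lambda>t. f (x(i := t)) + g (x(i := t))) differentiable (at (x i))"
    if "i \<in> N" "x \<in> coord_space N" for i x
    using has_partial_deriv_add[OF Suc.prems that] real_differentiable_def by blast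
  ultimately show ?case
    using Suc.prems by (simp add: continuous_map_add)
qed

lemma partial_deriv_const [simp]: "partial_deriv i (\<lambda>_. c) = (\<lambda>_. 0)"
  by (simp add: partial_deriv_def fun_eq_iff)

lemma n_times_cont_diff_const: "n_times_cont_diff n N (\<lambda>_. c)"
  by (induction n arbitrary: c) auto

lemma n_times_cont_diff_sum:
  assumes "finite A" "\<And>a. a \<in> A \<Longrightarrow> n_times_cont_diff n N (f a)"
  shows "n_times_cont_diff n N (\<lambda>x. \<Sum>a\<in>A. f a x)"
  using assms by (induction A rule: finite_induct) (auto intro: n_times_cont_diff_const n_times_cont_diff_add)

lemma n_times_cont_diff_cmult:
  assumes "n_times_cont_diff n N f"
  shows "n_times_cont_diff n N (\<lambda>x. c * f x)"
  using assms
proof (induction n arbitrary: f)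
  case 0
  then show ?case
    by (simp add: continuous_map_real_mult_left)
next
  case (Suc n)
  have deriv: "((\<lambda>t. c * f (x(i := t))) has_real_derivative c * partial_deriv i f x) (at (x i))"
    if "i \<in> N" "x \<in> coord_space N" for i x
    \<comment> \<open>\<open>fun_upd\<close> at the value already present is the identity: the point of evaluation is \<open>x\<close> itself.\<close>
    using DERIV_cmult[OF has_partial_deriv[OF Suc.prems that, of "x i"], of c] by (simp only: fun_upd_triv)
  have "n_times_cont_diff n N (partial_deriv i (\<lambda>x. c * f x))" if i: "i \<in> N" for i
  proof (rule n_times_cont_diff_cong)
    show "n_times_cont_diff n N (\<lambda>x. c * partial_deriv i f x)"
      using Suc i by simp
    show "c * partial_deriv i f x = partial_deriv i (\<lambda>x. c * f x) x" if "x \<in> coord_space N" for x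
      using deriv[OF i that] by (simp add: partial_deriv_def[of i "\<lambda>x. c * f x"] DERIV_imp_deriv)
  qed
  moreover have "(\<lambda>t. c * f (x(i := t))) differentiable (at (x i))"
    if "i \<in> N" "x \<in> coord_space N" for i x
    using deriv[OF that] real_differentiable_def by blast
  ultimately show ?case
    using Suc.prems by (simp add: continuous_map_real_mult_left)
qed

text \<open>
  This is the analytic core: a function whose partial derivatives are continuous may be differentiated
  along a diagonal, that is, in several coordinates moving together. The induction adds one
  coordinate at a time. If the coordinates in \<open>A\<close> are set to \<open>s\<close> and the new one to \<open>t\<close>, then \<open>f\<close> is
  differentiable in \<open>s\<close> at the base point by induction and has a partial derivative in \<open>t\<close> that is
  continuous in \<open>(s, t)\<close>. This makes it totally differentiable in \<open>(s, t)\<close> at the base point, and composition with the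
  diagonal \<open>t \<mapsto> (t, t)\<close> adds the two derivatives.
\<close>

lemma has_derivative_on_block:
  assumes f: "n_times_cont_diff (Suc n) N f"
    and "finite A" "A \<subseteq> N" "x \<in> coord_space N" "\<And>i. i \<in> A \<Longrightarrow> x i = c"
  shows "((\<lambda>t. f (\<lambda>i. if i \<in> A then t else x i)) has_real_derivative (\<Sum>i\<in>A. partial_deriv i f x)) (at c)"
  using assms(2-5)
proof (induction A rule: finite_induct)
  case empty
  then show ?case by simp
next
  case (insert k A)
  define z where "z s t = (\<lambda>i. if i \<in> A then s else x i)(k := t)" for s t
  have k: "k \<in> N" and "A \<subseteq> N"
    using insert.prems by auto
  have zN: "(\<lambda>i. if i \<in> A then s else x i) \<in> coord_space N" for s
    using \<open>A \<subseteq> N\<close> insert.prems(2) by (auto simp: coord_space_def PiE_def extensional_def)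
  have "z s c = (\<lambda>i. if i \<in> A then s else x i)" for s
    using insert.hyps insert.prems(3) by (auto simp: z_def)
  then have fst_deriv: "((\<lambda>s. f (z s c)) has_derivative (*) (\<Sum>i\<in>A. partial_deriv i f x)) (at c)"
    using insert.IH insert.prems by (simp add: has_field_derivative_def)
  have snd_deriv: "((\<lambda>t. f (z s t)) has_derivative
      blinfun_apply (blinfun_mult_right (partial_deriv k f (z s t)))) (at t)" for s t
    using has_partial_deriv[OF f k zN, of s t] by (simp add: z_def has_field_derivative_def)
  have "continuous_map euclidean euclideanreal (\<lambda>p. z (fst p) (snd p) i)" for i
    by (cases "i = k"; cases "i \<in> A") (auto simp: z_def intro!: continuous_intros)
  moreover have "z s t \<in> extensional N" for s t
    using zN[of s] k by (auto simp: z_def coord_space_def PiE_def extensional_def)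
  ultimately have "continuous_map euclidean (powertop_real N) (\<lambda>p. z (fst p) (snd p))"
    by (auto simp: continuous_map_componentwise)
  moreover have "continuous_map (powertop_real N) euclideanreal (partial_deriv k f)"
    using f k by (auto intro: n_times_cont_diff_continuous)
  ultimately have "continuous_map euclidean euclideanreal (partial_deriv k f \<circ> (\<lambda>p. z (fst p) (snd p)))"
    by (rule continuous_map_compose)
  then have "continuous (at (c, c)) (\<lambda>p. partial_deriv k f (z (fst p) (snd p)))"
    by (auto simp: comp_def continuous_on_eq_continuous_at)
  then have cont: "continuous (at (c, c)) (\<lambda>(s, t). blinfun_mult_right (partial_deriv k f (z s t)))"
    unfolding case_prod_unfold
    by (rule bounded_linear.continuous[OF bounded_linear_blinfun_mult_right])
  have "((\<lambda>(s, t). f (z s t)) has_derivative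
      (\<lambda>(u, v). (\<Sum>i\<in>A. partial_deriv i f x) * u + partial_deriv k f (z c c) * v)) (at (c, c))"
    using has_derivative_partialsI[where f = "\<lambda>s t. f (z s t)" and X = UNIV and Y = UNIV
        and x = c and y = c, OF fst_deriv snd_deriv] cont
    by simp
  then have "((\<lambda>t. case (t, t) of (s, t) \<Rightarrow> f (z s t)) has_derivative
      (\<lambda>h. case (h, h) of (u, v) \<Rightarrow> (\<Sum>i\<in>A. partial_deriv i f x) * u + partial_deriv k f (z c c) * v)) (at c)"
    by (rule has_derivative_compose[rotated]) (auto intro!: derivative_eq_intros)
  moreover have "(\<lambda>h. case (h, h) of (u, v) \<Rightarrow> (\<Sum>i\<in>A. partial_deriv i f x) * u + partial_deriv k f (z c c) * v)
      = (*) (partial_deriv k f (z c c) + (\<Sum>i\<in>A. partial_deriv i f x))"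
    by (auto simp: algebra_simps)
  ultimately have "((\<lambda>t. f (z t t)) has_real_derivative
      partial_deriv k f (z c c) + (\<Sum>i\<in>A. partial_deriv i f x)) (at c)"
    by (simp add: has_field_derivative_def)
  moreover have "z c c = x"
    using insert.prems(3) by (auto simp: z_def)
  moreover have "z t t = (\<lambda>i. if i \<in> insert k A then t else x i)" for t
    by (auto simp: z_def)
  ultimately show ?case
    using insert.hyps by simp
qed

text \<open>
  Moving the coordinate \<open>j\<close> of \<open>y\<close> moves exactly the coordinates of the pullback of \<open>y\<close> in the fibre
  over \<open>j\<close>, so the chain rule \<open>\<nabla>(f \<circ> \<phi>\<^sup>*) = \<phi>\<^sub>* \<circ> \<nabla>f \<circ> \<phi>\<^sup>*\<close> is the preceding lemma for that fibre.
\<close>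

lemma has_derivative_pullback:
  assumes f: "n_times_cont_diff (Suc n) N f" and "finite N"
    and y: "y \<in> coord_space M" and j: "j \<in> M"
  shows "((\<lambda>t. f (pullback N \<phi> (y(j := t)))) has_real_derivative
      (\<Sum>i\<in>{i\<in>N. \<phi> i = j}. partial_deriv i f (pullback N \<phi> y))) (at (y j))"
proof -
  have "(\<lambda>i. if i \<in> {i\<in>N. \<phi> i = j} then t else pullback N \<phi> y i) = pullback N \<phi> (y(j := t))" for t
    by (auto simp: pullback_def)
  moreover have "((\<lambda>t. f (\<lambda>i. if i \<in> {i\<in>N. \<phi> i = j} then t else pullback N \<phi> y i)) has_real_derivative
      (\<Sum>i\<in>{i\<in>N. \<phi> i = j}. partial_deriv i f (pullback N \<phi> y))) (at (y j))"
    by (rule has_derivative_on_block[OF f]) (use \<open>finite N\<close> in auto)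
  ultimately show ?thesis
    by simp
qed

lemma partial_deriv_pullback:
  assumes "n_times_cont_diff (Suc n) N f" "finite N" "y \<in> coord_space M" "j \<in> M"
  shows "partial_deriv j (\<lambda>y. f (pullback N \<phi> y)) y
    = (\<Sum>i\<in>{i\<in>N. \<phi> i = j}. partial_deriv i f (pullback N \<phi> y))"
  using has_derivative_pullback[OF assms] by (simp add: partial_deriv_def DERIV_imp_deriv)

lemma n_times_cont_diff_pullback:
  assumes "n_times_cont_diff n N f" "finite N" "\<phi> \<in> N \<rightarrow> M"
  shows "n_times_cont_diff n M (\<lambda>y. f (pullback N \<phi> y))"
  using assms(1)
proof (induction n arbitrary: f)
  case 0
  then show ?case
    using continuous_map_compose[OF continuous_map_pullback[OF assms(3)]] by (simp add: comp_def)
next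
  case (Suc n)
  have "n_times_cont_diff n M (partial_deriv j (\<lambda>y. f (pullback N \<phi> y)))" if j: "j \<in> M" for j
  proof (rule n_times_cont_diff_cong)
    show "n_times_cont_diff n M (\<lambda>y. \<Sum>i\<in>{i\<in>N. \<phi> i = j}. partial_deriv i f (pullback N \<phi> y))"
      using Suc assms(2) by (auto intro!: n_times_cont_diff_sum)
  qed (simp add: partial_deriv_pullback[OF Suc.prems assms(2) _ j])
  moreover have "(\<lambda>t. f (pullback N \<phi> (y(j := t)))) differentiable (at (y j))"
    if "j \<in> M" "y \<in> coord_space M" for j y
    using has_derivative_pullback[OF Suc.prems assms(2) that(2,1)] real_differentiable_def by blast
  moreover have "continuous_map (powertop_real M) euclideanreal (\<lambda>y. f (pullback N \<phi> y))"
    using continuous_map_compose[OF continuous_map_pullback[OF assms(3)]] Suc.prems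
    by (auto simp: comp_def)
  ultimately show ?case
    by simp
qed

lemma pullback_compose:
  assumes "\<phi> \<in> N \<rightarrow> M"
  shows "pullback N \<phi> (pullback M \<psi> y) = pullback N (compose N \<psi> \<phi>) y"
  using assms by (auto simp: pullback_def compose_def fun_eq_iff Pi_def)

text \<open>The fibre of a composite is partitioned by the fibres of the inner map.\<close>

lemma pushforward_compose:
  assumes "finite N" "finite M" "\<phi> \<in> N \<rightarrow> M"
  shows "pushforward M \<psi> L (pushforward N \<phi> M x) = pushforward N (compose N \<psi> \<phi>) L x"
proof (rule ext)
  fix l
  let ?T = "{j\<in>M. \<psi> j = l}" and ?S = "{i\<in>N. compose N \<psi> \<phi> i = l}"
  have "(\<Sum>j\<in>?T. pushforward N \<phi> M x j) = (\<Sum>j\<in>?T. \<Sum>i\<in>{i\<in>?S. \<phi> i = j}. x i)"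
    by (intro sum.cong) (auto simp: pushforward_def compose_def intro!: sum.cong)
  also have "\<dots> = (\<Sum>i\<in>?S. x i)"
    using assms by (intro sum.group) (auto simp: compose_def)
  finally show "pushforward M \<psi> L (pushforward N \<phi> M x) l = pushforward N (compose N \<psi> \<phi>) L x l"
    by (simp add: pushforward_def[of M] pushforward_def[of N "compose N \<psi> \<phi>"])
qed

lemma pullback_restrict [simp]: "pullback N (restrict \<phi> N) y = pullback N \<phi> y"
  by (auto simp: pullback_def)

lemma pushforward_restrict [simp]: "pushforward N (restrict \<phi> N) M x = pushforward N \<phi> M x"
  by (auto simp: pushforward_def fun_eq_iff intro!: sum.cong)

lemma pushforward_add:
  "pushforward N \<phi> M (\<lambda>i\<in>N. x i + y i) = (\<lambda>j\<in>M. pushforward N \<phi> M x j + pushforward N \<phi> M y j)"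
  by (auto simp: pushforward_def fun_eq_iff simp flip: sum.distrib)

lemma pushforward_zero: "pushforward N \<phi> M (\<lambda>i\<in>N. 0) = (\<lambda>j\<in>M. 0)"
  by (auto simp: pushforward_def fun_eq_iff)

lemma pullback_ident: "y \<in> coord_space N \<Longrightarrow> pullback N (\<lambda>i. i) y = y"
  by (auto simp: pullback_def coord_space_def PiE_def extensional_def)

lemma pushforward_ident:
  assumes "x \<in> coord_space N"
  shows "pushforward N (\<lambda>i. i) N x = x"
proof -
  have "{i\<in>N. i = j} = {j}" if "j \<in> N" for j
    using that by auto
  then show ?thesis
    using assms by (auto simp: pushforward_def coord_space_def PiE_def extensional_def fun_eq_iff)
qed

section \<open>The classes \<open>C\<^sup>r\<close>\<close>

lemma C_class_D: "C_class r N f \<Longrightarrow> enat n \<le> r \<Longrightarrow> n_times_cont_diff n N f"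
  by (simp add: C_class_def)

lemma C_class_cong: "(\<And>x. x \<in> coord_space N \<Longrightarrow> f x = g x) \<Longrightarrow> C_class r N f \<Longrightarrow> C_class r N g"
  unfolding C_class_def by (blast intro: n_times_cont_diff_cong)

lemma C_class_restrict [simp]: "C_class r N (restrict f (coord_space N)) \<longleftrightarrow> C_class r N f"
  by (auto elim!: C_class_cong[rotated])

lemma C_class_add: "C_class r N f \<Longrightarrow> C_class r N g \<Longrightarrow> C_class r N (\<lambda>x. f x + g x)"
  by (simp add: C_class_def n_times_cont_diff_add)

lemma C_class_cmult: "C_class r N f \<Longrightarrow> C_class r N (\<lambda>x. c * f x)"
  by (simp add: C_class_def n_times_cont_diff_cmult)

lemma C_class_const: "C_class r N (\<lambda>_. c)"
  by (simp add: C_class_def n_times_cont_diff_const)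

lemma C_class_sum:
  "finite A \<Longrightarrow> (\<And>a. a \<in> A \<Longrightarrow> C_class r N (f a)) \<Longrightarrow> C_class r N (\<lambda>x. \<Sum>a\<in>A. f a x)"
  by (simp add: C_class_def n_times_cont_diff_sum)

lemma C_class_pullback:
  "C_class r N f \<Longrightarrow> finite N \<Longrightarrow> \<phi> \<in> N \<rightarrow> M \<Longrightarrow> C_class r M (\<lambda>y. f (pullback N \<phi> y))"
  by (simp add: C_class_def n_times_cont_diff_pullback)

lemma C_class_Suc_D:
  assumes "C_class (r + 1) N f"
  shows "n_times_cont_diff (Suc 0) N f"
proof (rule C_class_D[OF assms])
  show "enat (Suc 0) \<le> r + 1"
    using add_mono[of 0 r 1 "1::enat"] by (simp add: one_enat_def)
qed

text \<open>
  The gradient loses one derivative. For \<open>r = \<infinity>\<close> the successor is absorbed, so that smooth functions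
  have smooth gradients.
\<close>

lemma C_class_partial_deriv:
  assumes "C_class (r + 1) N f" "i \<in> N"
  shows "C_class r N (partial_deriv i f)"
  unfolding C_class_def
proof (intro allI impI)
  fix n assume "enat n \<le> r"
  then have "enat (Suc n) \<le> r + 1"
    by (cases r) (auto simp: one_enat_def)
  then have "n_times_cont_diff (Suc n) N f"
    by (rule C_class_D[OF assms(1)])
  then show "n_times_cont_diff n N (partial_deriv i f)"
    using assms(2) by simp
qed

section \<open>Partial convexity\<close>

lemma convex_in_coords_cong:
  assumes "\<And>x. x \<in> coord_space N \<Longrightarrow> f x = g x"
  shows "convex_in_coords N A f \<longleftrightarrow> convex_in_coords N A g"
  unfolding convex_in_coords_def using assms by simp

lemma convex_in_coords_restrict [simp]:
  "convex_in_coords N A (restrict f (coord_space N)) \<longleftrightarrow> convex_in_coords N A f"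
  by (rule convex_in_coords_cong) simp

lemma convex_in_coords_add:
  assumes "convex_in_coords N A f" "convex_in_coords N A g"
  shows "convex_in_coords N A (\<lambda>x. f x + g x)"
  unfolding convex_in_coords_def
proof (intro ballI impI)
  fix x y t
  assume "x \<in> coord_space N" "y \<in> coord_space N" "\<forall>i\<in>N - A. x i = y i" "t \<in> {0..1::real}"
  then have "f (\<lambda>i\<in>N. (1 - t) * x i + t * y i) \<le> (1 - t) * f x + t * f y"
    "g (\<lambda>i\<in>N. (1 - t) * x i + t * y i) \<le> (1 - t) * g x + t * g y"
    using assms by (auto simp: convex_in_coords_def)
  then show "f (\<lambda>i\<in>N. (1 - t) * x i + t * y i) + g (\<lambda>i\<in>N. (1 - t) * x i + t * y i)
      \<le> (1 - t) * (f x + g x) + t * (f y + g y)"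
    by (simp add: algebra_simps)
qed

lemma convex_in_coords_const: "convex_in_coords N A (\<lambda>_. c)"
  by (simp add: convex_in_coords_def algebra_simps)

text \<open>
  Pullback is linear, and it sends points that differ only in the coordinates in \<open>B\<close> to points that
  differ only in the coordinates over \<open>B\<close>.
\<close>

lemma convex_in_coords_pullback:
  fixes \<phi> :: "'i \<Rightarrow> 'j"
  assumes f: "convex_in_coords N A f" and \<phi>: "\<phi> \<in> N \<rightarrow> M" "\<And>i. i \<in> N \<Longrightarrow> \<phi> i \<in> B \<Longrightarrow> i \<in> A"
  shows "convex_in_coords M B (\<lambda>y. f (pullback N \<phi> y))"
  unfolding convex_in_coords_def
proof (intro ballI impI)
  fix x y :: "'j \<Rightarrow> real" and t
  assume xy: "\<forall>j\<in>M - B. x j = y j" and t: "t \<in> {0..1::real}"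
  have "pullback N \<phi> (\<lambda>j\<in>M. (1 - t) * x j + t * y j)
      = (\<lambda>i\<in>N. (1 - t) * pullback N \<phi> x i + t * pullback N \<phi> y i)"
    using \<phi>(1) by (auto simp: pullback_def fun_eq_iff)
  moreover have "\<forall>i\<in>N - A. pullback N \<phi> x i = pullback N \<phi> y i"
    using \<phi> xy by auto
  ultimately show "f (pullback N \<phi> (\<lambda>j\<in>M. (1 - t) * x j + t * y j))
      \<le> (1 - t) * f (pullback N \<phi> x) + t * f (pullback N \<phi> y)"
    using f t by (simp add: convex_in_coords_def)
qed

lemma concave_in_coords_restrict [simp]:
  "concave_in_coords N A (restrict f (coord_space N)) \<longleftrightarrow> concave_in_coords N A f"
  unfolding concave_in_coords_def by (rule convex_in_coords_cong) simp

lemma concave_in_coords_add: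
  "concave_in_coords N A f \<Longrightarrow> concave_in_coords N A g \<Longrightarrow> concave_in_coords N A (\<lambda>x. f x + g x)"
  using convex_in_coords_add[of N A "\<lambda>x. - f x" "\<lambda>x. - g x"]
  by (simp add: concave_in_coords_def algebra_simps)

lemma concave_in_coords_const: "concave_in_coords N A (\<lambda>_. c)"
  unfolding concave_in_coords_def by (rule convex_in_coords_const)

lemma concave_in_coords_pullback:
  assumes "concave_in_coords N A f" "\<phi> \<in> N \<rightarrow> M" "\<And>i. i \<in> N \<Longrightarrow> \<phi> i \<in> B \<Longrightarrow> i \<in> A"
  shows "concave_in_coords M B (\<lambda>y. f (pullback N \<phi> y))"
  using assms unfolding concave_in_coords_def by (rule convex_in_coords_pullback)

section \<open>The two functors and the flow\<close>

lemma DiffSaddle_simps: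
  "f \<in> FObj (DiffSaddle r) X \<longleftrightarrow> f \<in> extensional (coord_space (fst X)) \<and> C_class r (fst X) f \<and>
     convex_in_coords (fst X) {i\<in>fst X. snd X i = 1} f \<and>
     concave_in_coords (fst X) {i\<in>fst X. snd X i = 2} f"
  "FArr (DiffSaddle r) (X, \<phi>, Y) f = (\<lambda>y\<in>coord_space (fst Y). f (pullback (fst X) \<phi> y))"
  "FProd (DiffSaddle r) X Y (f, g) = (\<lambda>z\<in>coord_space (fst X \<oplus> fst Y).
     f (pullback (fst X) InL z) + g (pullback (fst Y) InR z))"
  "FUnit (DiffSaddle r) = (\<lambda>x\<in>coord_space {}. 0)"
  by (auto simp: DiffSaddle_def PiE_def split: prod.splits)

lemma FObj_Dynam_U: "\<upsilon> \<in> FObj (Dynam r \<circ>\<^sub>F U) X \<longleftrightarrow>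
  \<upsilon> \<in> coord_space (fst X) \<rightarrow>\<^sub>E coord_space (fst X) \<and> (\<forall>i\<in>fst X. C_class r (fst X) (\<lambda>x. \<upsilon> x i))"
  by (simp add: Dynam_def comp_functor_def U_def)

lemma FArr_Dynam_U: "FArr (Dynam r \<circ>\<^sub>F U) (X, \<phi>, Y) \<upsilon> =
  (\<lambda>y\<in>coord_space (fst Y). pushforward (fst X) \<phi> (fst Y) (\<upsilon> (pullback (fst X) \<phi> y)))"
  by (simp add: Dynam_def comp_functor_def U_def)

lemma FProd_Dynam_U: "FProd (Dynam r \<circ>\<^sub>F U) X Y (\<upsilon>, \<rho>) =
  (\<lambda>z\<in>coord_space (fst X \<oplus> fst Y). \<lambda>j\<in>fst X \<oplus> fst Y.
     pushforward (fst X) InL (fst X \<oplus> fst Y) (\<upsilon> (pullback (fst X) InL z)) j +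
     pushforward (fst Y) InR (fst X \<oplus> fst Y) (\<rho> (pullback (fst Y) InR z)) j)"
  by (simp add: Dynam_def comp_functor_def U_def FinSet_def pullback_ident pushforward_ident
      cong: restrict_cong)

lemma FUnit_Dynam_U: "FUnit (Dynam r \<circ>\<^sub>F U) = (\<lambda>x\<in>coord_space {}. \<lambda>i\<in>{}. 0)"
  by (auto simp: Dynam_def comp_functor_def U_def FinSet_def pullback_ident pushforward_def
      fun_eq_iff intro!: restrict_ext)

lemmas Dynam_U_simps = FObj_Dynam_U FArr_Dynam_U FProd_Dynam_U FUnit_Dynam_U

text \<open>
  Sums of functions and of vector fields are restricted to the coordinate spaces, so that they are
  again extensional; these are the monoid structures of the two functors.
\<close>

definition saddle_add ::
  "'a slice_obj \<Rightarrow> (('a elt \<Rightarrow> real) \<Rightarrow> real) \<Rightarrow> (('a elt \<Rightarrow> real) \<Rightarrow> real) \<Rightarrow> ('a elt \<Rightarrow> real) \<Rightarrow> real" where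
  "saddle_add X f g = (\<lambda>x\<in>coord_space (fst X). f x + g x)"

definition saddle_zero :: "'a slice_obj \<Rightarrow> ('a elt \<Rightarrow> real) \<Rightarrow> real" where
  "saddle_zero X = (\<lambda>x\<in>coord_space (fst X). 0)"

definition field_add :: "'a slice_obj \<Rightarrow> (('a elt \<Rightarrow> real) \<Rightarrow> 'a elt \<Rightarrow> real) \<Rightarrow>
    (('a elt \<Rightarrow> real) \<Rightarrow> 'a elt \<Rightarrow> real) \<Rightarrow> ('a elt \<Rightarrow> real) \<Rightarrow> 'a elt \<Rightarrow> real" where
  "field_add X \<upsilon> \<rho> = (\<lambda>x\<in>coord_space (fst X). \<lambda>i\<in>fst X. \<upsilon> x i + \<rho> x i)"

definition field_zero :: "'a slice_obj \<Rightarrow> ('a elt \<Rightarrow> real) \<Rightarrow> 'a elt \<Rightarrow> real" where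
  "field_zero X = (\<lambda>x\<in>coord_space (fst X). \<lambda>i\<in>fst X. 0)"

lemma DiffSaddle_additive:
  "additive_set_functor FinSet2 slice_inl slice_inr (DiffSaddle r) saddle_add saddle_zero"
proof -
  interpret cocartesian_monoidal_category FinSet2 slice_inl slice_inr by (rule FinSet2_cocartesian)
  show ?thesis
  proof (unfold_locales, goal_cases map_mem map_ident map_comp add_mem zero_mem add_assoc
      add_commute add_zero map_add map_zero prod_eq unit_eq)
    case (map_mem X Y h f)
    from map_mem(3) obtain \<phi> where h: "h = (X, \<phi>, Y)"
      and \<phi>: "\<phi> \<in> fst X \<rightarrow> fst Y" "\<And>i. i \<in> fst X \<Longrightarrow> snd Y (\<phi> i) = snd X i"
      by (auto elim!: Hom_FinSet2E)
    have "convex_in_coords (fst Y) {j\<in>fst Y. snd Y j = 1} (\<lambda>y. f (pullback (fst X) \<phi> y))"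
      by (rule convex_in_coords_pullback[where A = "{i\<in>fst X. snd X i = 1}"])
        (use map_mem(4) \<phi> in \<open>simp_all add: DiffSaddle_simps\<close>)
    moreover have "concave_in_coords (fst Y) {j\<in>fst Y. snd Y j = 2} (\<lambda>y. f (pullback (fst X) \<phi> y))"
      by (rule concave_in_coords_pullback[where A = "{i\<in>fst X. snd X i = 2}"])
        (use map_mem(4) \<phi> in \<open>simp_all add: DiffSaddle_simps\<close>)
    ultimately show ?case
      using map_mem(1,4) \<phi> by (simp add: h DiffSaddle_simps Obj_FinSet2 C_class_pullback)
  next
    case (map_ident X f)
    then show ?case
      by (auto simp: DiffSaddle_simps FinSet2_simps pullback_ident extensional_def fun_eq_iff)
  next
    case (map_comp X Y Z h h' f)
    then show ?case
      by (auto simp: DiffSaddle_simps FinSet2_simps pullback_compose[of _ "fst X" "fst Y"]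
          elim!: Hom_FinSet2E intro!: restrict_ext)
  next
    case (add_mem X f g)
    then show ?case
      by (simp add: DiffSaddle_simps saddle_add_def C_class_add convex_in_coords_add
          concave_in_coords_add)
  next
    case (zero_mem X)
    show ?case
      by (simp add: DiffSaddle_simps saddle_zero_def C_class_const convex_in_coords_const
          concave_in_coords_const)
  next
    case add_assoc
    then show ?case by (auto simp: saddle_add_def fun_eq_iff)
  next
    case add_commute
    then show ?case by (auto simp: saddle_add_def fun_eq_iff)
  next
    case add_zero
    then show ?case
      by (auto simp: saddle_add_def saddle_zero_def DiffSaddle_simps extensional_def fun_eq_iff)
  next
    case map_add
    then show ?case
      by (auto simp: DiffSaddle_simps saddle_add_def elim!: Hom_FinSet2E intro!: restrict_ext)
  next
    case map_zero
    then show ?case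
      by (auto simp: DiffSaddle_simps saddle_zero_def elim!: Hom_FinSet2E intro!: restrict_ext)
  next
    case prod_eq
    then show ?case
      by (auto simp: DiffSaddle_simps saddle_add_def slice_inl_def slice_inr_def FinSet2_simps
          intro!: restrict_ext)
  next
    case unit_eq
    show ?case
      by (simp add: DiffSaddle_simps saddle_zero_def FinSet2_simps)
  qed
qed

lemma Dynam_U_additive:
  "additive_set_functor FinSet2 slice_inl slice_inr (Dynam r \<circ>\<^sub>F U) field_add field_zero"
proof -
  interpret cocartesian_monoidal_category FinSet2 slice_inl slice_inr by (rule FinSet2_cocartesian)
  show ?thesis
  proof (unfold_locales, goal_cases map_mem map_ident map_comp add_mem zero_mem add_assoc
      add_commute add_zero map_add map_zero prod_eq unit_eq)
    case (map_mem X Y h \<upsilon>)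
    from map_mem(3) obtain \<phi> where h: "h = (X, \<phi>, Y)" and \<phi>: "\<phi> \<in> fst X \<rightarrow> fst Y"
      by (auto elim!: Hom_FinSet2E)
    have "C_class r (fst Y) (\<lambda>y. FArr (Dynam r \<circ>\<^sub>F U) h \<upsilon> y j)" if j: "j \<in> fst Y" for j
    proof (rule C_class_cong)
      show "C_class r (fst Y) (\<lambda>y. \<Sum>i\<in>{i\<in>fst X. \<phi> i = j}. \<upsilon> (pullback (fst X) \<phi> y) i)"
        using map_mem(1,4) \<phi>
        by (intro C_class_sum C_class_pullback[where f = "\<lambda>x. \<upsilon> x _"])
          (auto simp: Obj_FinSet2 Dynam_U_simps)
    qed (use j in \<open>simp add: h Dynam_U_simps pushforward_def\<close>)
    then show ?case
      by (simp add: h Dynam_U_simps)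
  next
    case (map_ident X \<upsilon>)
    then have "\<upsilon> x \<in> coord_space (fst X)" if "x \<in> coord_space (fst X)" for x
      using that by (auto simp: Dynam_U_simps)
    with map_ident show ?case
      by (auto simp: Dynam_U_simps FinSet2_simps pullback_ident pushforward_ident PiE_def
          intro!: extensionalityI[where A = "coord_space (fst X)"])
  next
    case (map_comp X Y Z h h' \<upsilon>)
    then have "finite (fst X)" "finite (fst Y)"
      by (auto simp: Obj_FinSet2)
    with map_comp show ?case
      by (auto simp: Dynam_U_simps FinSet2_simps pullback_compose[of _ "fst X" "fst Y"]
          pushforward_compose[of "fst X" "fst Y"] elim!: Hom_FinSet2E intro!: restrict_ext)
  next
    case (add_mem X \<upsilon> \<rho>)
    have "C_class r (fst X) (\<lambda>x. field_add X \<upsilon> \<rho> x i)" if i: "i \<in> fst X" for i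
    proof (rule C_class_cong)
      show "C_class r (fst X) (\<lambda>x. \<upsilon> x i + \<rho> x i)"
        using add_mem i by (auto simp: Dynam_U_simps intro: C_class_add)
    qed (use i in \<open>simp add: field_add_def\<close>)
    then show ?case
      by (simp add: Dynam_U_simps) (simp add: field_add_def)
  next
    case (zero_mem X)
    have "C_class r (fst X) (\<lambda>x. field_zero X x i)" if i: "i \<in> fst X" for i
      by (rule C_class_cong[OF _ C_class_const[of r _ 0]]) (use i in \<open>simp add: field_zero_def\<close>)
    then show ?case
      by (simp add: Dynam_U_simps) (simp add: field_zero_def)
  next
    case add_assoc
    then show ?case by (auto simp: field_add_def fun_eq_iff)
  next
    case add_commute
    then show ?case by (auto simp: field_add_def fun_eq_iff)
  next
    case (add_zero X \<upsilon>)
    have "field_add X (field_zero X) \<upsilon> x = \<upsilon> x" if x: "x \<in> coord_space (fst X)" for x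
    proof -
      have "\<upsilon> x \<in> extensional (fst X)"
        using add_zero(2) x by (auto simp: Dynam_U_simps coord_space_def PiE_def)
      then have "restrict (\<upsilon> x) (fst X) = \<upsilon> x"
        by (rule extensional_restrict)
      moreover have "field_add X (field_zero X) \<upsilon> x = restrict (\<upsilon> x) (fst X)"
        using x by (auto simp: field_add_def field_zero_def)
      ultimately show ?thesis
        by simp
    qed
    moreover have "\<upsilon> \<in> extensional (coord_space (fst X))"
      using add_zero(2) by (simp add: Dynam_U_simps PiE_def)
    ultimately show ?case
      by (intro extensionalityI[where A = "coord_space (fst X)"]) (simp_all add: field_add_def)
  next
    case map_add
    then show ?case
      by (auto simp: Dynam_U_simps field_add_def pushforward_add elim!: Hom_FinSet2E
          intro!: restrict_ext)
  next
    case map_zero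
    then show ?case
      by (auto simp: Dynam_U_simps field_zero_def pushforward_zero elim!: Hom_FinSet2E
          intro!: restrict_ext)
  next
    case prod_eq
    then show ?case
      by (auto simp: Dynam_U_simps field_add_def slice_inl_def slice_inr_def FinSet2_simps
          intro!: restrict_ext)
  next
    case unit_eq
    show ?case
      by (simp add: Dynam_U_simps field_zero_def FinSet2_simps)
  qed
qed

text \<open>
  Descent in the convex coordinates and ascent in the concave ones. The restrictions make the flow
  extensional on \<open>\<real>\<^sup>N\<close> and its values elements of \<open>\<real>\<^sup>N\<close>.
\<close>

definition saddle_flow ::
  "'a slice_obj \<Rightarrow> (('a elt \<Rightarrow> real) \<Rightarrow> real) \<Rightarrow> ('a elt \<Rightarrow> real) \<Rightarrow> 'a elt \<Rightarrow> real" where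
  "saddle_flow X f = (\<lambda>x\<in>coord_space (fst X). \<lambda>i\<in>fst X.
     (if snd X i = 1 then -1 else 1) * partial_deriv i f x)"

lemma saddle_flow_mem:
  assumes "f \<in> FObj (DiffSaddle (r + 1)) X"
  shows "saddle_flow X f \<in> FObj (Dynam r \<circ>\<^sub>F U) X"
proof -
  have "C_class r (fst X) (\<lambda>x. saddle_flow X f x i)" if i: "i \<in> fst X" for i
  proof (rule C_class_cong)
    show "C_class r (fst X) (\<lambda>x. (if snd X i = 1 then -1 else 1) * partial_deriv i f x)"
      using assms i by (intro C_class_cmult C_class_partial_deriv) (auto simp: DiffSaddle_simps)
  qed (use i in \<open>simp add: saddle_flow_def\<close>)
  then show ?thesis
    by (simp add: Dynam_U_simps) (simp add: saddle_flow_def)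
qed

text \<open>
  This is the chain rule for the pullback along \<open>\<phi>\<close>. The sign of the flow at \<open>j\<close> can be moved inside the
  sum over the fibre of \<open>j\<close> because \<open>\<phi>\<close> preserves labels, hence the sign is constant on the fibre.
\<close>

lemma saddle_flow_natural:
  assumes X: "X \<in> Obj FinSet2" and h: "h \<in> Hom FinSet2 X Y"
    and f: "f \<in> FObj (DiffSaddle (r + 1)) X"
  shows "saddle_flow Y (FArr (DiffSaddle (r + 1)) h f) = FArr (Dynam r \<circ>\<^sub>F U) h (saddle_flow X f)"
proof -
  obtain \<phi> where hdef: "h = (X, \<phi>, Y)" and lab: "\<And>i. i \<in> fst X \<Longrightarrow> snd Y (\<phi> i) = snd X i"
    using h by (auto elim!: Hom_FinSet2E)
  have f1: "n_times_cont_diff (Suc 0) (fst X) f"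
    by (rule C_class_Suc_D[of r]) (use f in \<open>simp add: DiffSaddle_simps\<close>)
  have "(if snd Y j = 1 then -1 else 1) * partial_deriv j (FArr (DiffSaddle (r + 1)) h f) y
      = (\<Sum>i\<in>{i\<in>fst X. \<phi> i = j}. (if snd X i = 1 then -1 else 1) * partial_deriv i f (pullback (fst X) \<phi> y))"
    if y: "y \<in> coord_space (fst Y)" and j: "j \<in> fst Y" for y j
  proof -
    have "partial_deriv j (FArr (DiffSaddle (r + 1)) h f) y
        = partial_deriv j (\<lambda>y. f (pullback (fst X) \<phi> y)) y"
      by (rule partial_deriv_cong[OF _ y j]) (simp add: hdef DiffSaddle_simps)
    also have "\<dots> = (\<Sum>i\<in>{i\<in>fst X. \<phi> i = j}. partial_deriv i f (pullback (fst X) \<phi> y))"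
      using X by (intro partial_deriv_pullback[OF f1 _ y j]) (simp add: Obj_FinSet2)
    finally have grad: "partial_deriv j (FArr (DiffSaddle (r + 1)) h f) y = \<dots>" .
    show ?thesis
      unfolding grad sum_distrib_left by (rule sum.cong) (auto simp: lab)
  qed
  then show ?thesis
    by (auto simp: hdef Dynam_U_simps saddle_flow_def pushforward_def intro!: restrict_ext sum.cong)
qed

lemma saddle_flow_add:
  assumes "f \<in> FObj (DiffSaddle (r + 1)) X" "g \<in> FObj (DiffSaddle (r + 1)) X"
  shows "saddle_flow X (saddle_add X f g) = field_add X (saddle_flow X f) (saddle_flow X g)"
proof -
  have "n_times_cont_diff (Suc 0) (fst X) f" "n_times_cont_diff (Suc 0) (fst X) g"
    by (rule C_class_Suc_D[of r], use assms in \<open>simp add: DiffSaddle_simps\<close>)+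
  note grad_add = partial_deriv_add[OF this]
  have "partial_deriv i (saddle_add X f g) x = partial_deriv i f x + partial_deriv i g x"
    if x: "x \<in> coord_space (fst X)" and i: "i \<in> fst X" for x i
  proof -
    have "partial_deriv i (saddle_add X f g) x = partial_deriv i (\<lambda>x. f x + g x) x"
      by (rule partial_deriv_cong[OF _ x i]) (simp add: saddle_add_def)
    then show ?thesis
      by (simp add: grad_add[OF i x])
  qed
  then show ?thesis
    by (auto simp: saddle_flow_def field_add_def intro!: restrict_ext)
qed

lemma saddle_flow_zero: "saddle_flow X (saddle_zero X) = field_zero X"
  using partial_deriv_cong[of "fst X" "saddle_zero X" "\<lambda>_. 0"]
  by (auto simp: saddle_flow_def field_zero_def saddle_zero_def intro!: restrict_ext)

theorem theorem4p4:
  fixes r :: enat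
  shows "\<exists>flow :: 'a slice_obj \<Rightarrow> (('a elt \<Rightarrow> real) \<Rightarrow> real) \<Rightarrow> ('a elt \<Rightarrow> real) \<Rightarrow> 'a elt \<Rightarrow> real.
    monoidal_natural_transformation FinSet2 (DiffSaddle (r + 1)) (Dynam r \<circ>\<^sub>F U) flow \<and>
    (\<forall>N \<tau>. (N, \<tau>) \<in> Obj FinSet2 \<longrightarrow>
      (\<forall>f \<in> FObj (DiffSaddle (r + 1)) (N, \<tau>). \<forall>x \<in> coord_space N. \<forall>i \<in> N.
        (\<tau> i = 1 \<longrightarrow> flow (N, \<tau>) f x i = - grad N f x i) \<and>
        (\<tau> i = 2 \<longrightarrow> flow (N, \<tau>) f x i = grad N f x i)))"
proof (intro exI conjI)
  show "monoidal_natural_transformation FinSet2 (DiffSaddle (r + 1)) (Dynam r \<circ>\<^sub>F U)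
      (saddle_flow :: 'a slice_obj \<Rightarrow> _)"
    by (rule additive_natural_transformation_monoidal[OF DiffSaddle_additive Dynam_U_additive])
      (auto intro: saddle_flow_mem saddle_flow_natural saddle_flow_add saddle_flow_zero)
qed (simp add: saddle_flow_def grad_def)

end
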